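(* Let $p$ be a prime. The following hold. (1) $I_{\max}=2$ for each of the following groups: (A1) $\langle a,b,c\mid a^4=b^2=c^4=1,[a,b]=c,[c,a]=[c,b]=c^2\rangle$; (A2) $\langle a,b,c\mid a^4=b^4=1,c^2=a^2,[a,b]=c,[c,a]=[c,b]=c^2\rangle$; (A3) $\langle a,b,c\mid a^8=b^2=1,c^2=a^4,[a,b]=c,[c,a]=[c,b]=c^2\rangle$; (C1) $\langle a,b,c\mid a^8=1,c^2=a^4=b^4,[a,b]=c,[c,a]=1,[c,b]=1\rangle$; (C2) $\langle a,b,c\mid a^8=b^4=1,c^2=a^4,[a,b]=c,[c,a]=[c,b]=1\rangle$; (C3) $\langle a,b,c\mid a^8=1,c^2=a^4=b^4,[a,b]=c,[c,a]=1,[c,b]=c^2\rangle$; (C4) $\langle a,b,c\mid a^8=b^4=1,c^2=a^4,[a,b]=c,[c,a]=1,[c,b]=c^2\rangle$; (C5) $\langle a,b,c\mid a^8=b^4=1,c^2=a^4,[a,b]=c,[c,a]=c^2,[c,b]=1\rangle$; (D3) $\langle a,b,c\mid a^{p^{n+1}}=b^{p^n}=1,c^p=a^{p^n},[a,b]=c,[c,a]=1,[c,b]=1\rangle$, where $n\ge2$, and $n\ge3$ if $p=2$; (D5) $\langle a,b,c\mid a^{p^n}=b^{p^n}=c^{p^2}=1,[a,b]=c,[c,a]=1,[c,b]=1\rangle$, where $n\ge2$, and $n\ge3$ if $p=2$; (E3) $\langle a,b,c\mid a^{p^{n+1}}=b^{p^m}=1,c^p=a^{p^n},[a,b]=c,[c,a]=1,[c,b]=1\rangle$,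 where $n>m\ge2$; (E6) $\langle a,b,c\mid a^{p^n}=b^{p^{m+1}}=1,c^p=b^{p^m},[a,b]=c,[c,a]=1,[c,b]=1\rangle$, where $n>m\ge2$; (E9) $\langle a,b,c\mid a^{p^n}=b^{p^m}=c^{p^2}=1,[a,b]=c,[c,a]=1,[c,b]=1\rangle$, where $n>m\ge2$. (2) $I_{\max}=n$ for each of the following groups: (B1) $\langle a,b,c\mid a^{2^{n+1}}=b^2=1,c^2=a^{2^n},[a,b]=c,[c,a]=1,[c,b]=c^2\rangle$, where $n\ge3$; (B2) $\langle a,b,c\mid a^{2^n}=b^2=c^4=1,[a,b]=c,[c,a]=1,[c,b]=c^2\rangle$, where $n\ge3$; (B3) $\langle a,b,c\mid a^{2^n}=b^4=1,c^2=b^2,[a,b]=c,[c,a]=1,[c,b]=c^2\rangle$, where $n\ge3$; (D1) $\langle a,b,c\mid a^{p^{n+1}}=b^{p^n}=1,c^p=a^{p^n},[a,b]=c,[c,a]=1,[c,b]=c^{tp}\rangle$, where $n\ge2$, $n\ge3$ if $p=2$, and $t\in F_p^*$; (D2) $\langle a,b,c\mid a^{p^{n+1}}=b^{p^n}=1,c^p=a^{p^n},[a,b]=c,[c,a]=c^p,[c,b]=1\rangle$, where $n\ge2$, and $n\ge3$ if $p=2$; (D4) $\langle a,b,c\mid a^{p^n}=b^{p^n}=c^{p^2}=1,[a,b]=c,[c,a]=c^p,[c,b]=1\rangle$, where $n\ge2$, and $n\ge3$ if $p=2$; (E1) $\langle a,b,c\mid a^{p^{n+1}}=b^{p^m}=1,c^p=a^{p^n},[a,b]=c,[c,a]=1,[c,b]=c^{tp}\rangle$,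 where $n>m\ge2$ and $t\in F_p^*$; (E4) $\langle a,b,c\mid a^{p^n}=b^{p^{m+1}}=1,c^p=b^{p^m},[a,b]=c,[c,a]=1,[c,b]=c^p\rangle$, where $n>m\ge2$; (E7) $\langle a,b,c\mid a^{p^n}=b^{p^m}=c^{p^2}=1,[a,b]=c,[c,a]=1,[c,b]=c^p\rangle$, where $n>m\ge2$. (3) $I_{\max}=m$ for each of the following groups, where $n>m\ge2$: (E2) $\langle a,b,c\mid a^{p^{n+1}}=b^{p^m}=1,c^p=a^{p^n},[a,b]=c,[c,a]=c^p,[c,b]=1\rangle$; (E5) $\langle a,b,c\mid a^{p^n}=b^{p^{m+1}}=1,c^p=b^{p^m},[a,b]=c,[c,a]=c^{tp},[c,b]=1\rangle$, where $t\in F_p^*$; (E8) $\langle a,b,c\mid a^{p^n}=b^{p^m}=c^{p^2}=1,[a,b]=c,[c,a]=c^p,[c,b]=1\rangle$.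
   Context: $[x,y]=x^{-1}y^{-1}xy$. An $\mathcal{A}_1$-group is a minimal non-abelian $p$-group. For a finite non-abelian $p$-group $G$, $p^{I_{\max}}$ denotes the maximal index in $G$ of the $\mathcal{A}_1$-subgroups of $G$. $F_p^*$ is the multiplicative group of the field with $p$ elements. The groups of types (A), (B), (C) are 2-groups (i.e. $p=2$ there). *)

theory Defs
  imports "HOL-Algebra.Coset" "HOL-Computational_Algebra.Primes"
begin

section \<open>Group presentations\<close>

text \<open>
  A letter \<open>(x, True)\<close> stands for the generator \<open>x\<close> and \<open>(x, False)\<close> for its formal inverse.
  A relation \<open>u = v\<close> is the pair of words \<open>(u, v)\<close>.
\<close>

type_synonym 'g gword = "('g \<times> bool) list"

definition gw_inv :: "'g gword \<Rightarrow> 'g gword" where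
  "gw_inv w = rev (map (\<lambda>(x, e). (x, \<not> e)) w)"

definition gw_pow :: "'g gword \<Rightarrow> nat \<Rightarrow> 'g gword"  (infixr "\<up>" 80) where
  "w \<up> k = concat (replicate k w)"

definition gw_comm :: "'g gword \<Rightarrow> 'g gword \<Rightarrow> 'g gword" where
  "gw_comm u v = gw_inv u @ gw_inv v @ u @ v"

abbreviation gw_eq :: "'g gword \<Rightarrow> 'g gword \<Rightarrow> 'g gword \<times> 'g gword"  (infix "\<doteq>" 50) where
  "u \<doteq> v \<equiv> (u, v)"

inductive pres_cong :: "('g gword \<times> 'g gword) set \<Rightarrow> 'g gword \<Rightarrow> 'g gword \<Rightarrow> bool"
  for R where
  relation: "(u, v) \<in> R \<Longrightarrow> pres_cong R u v"
| cancel: "pres_cong R [(x, e), (x, \<not> e)] []"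
| refl: "pres_cong R u u"
| sym: "pres_cong R u v \<Longrightarrow> pres_cong R v u"
| trans: "pres_cong R u v \<Longrightarrow> pres_cong R v w \<Longrightarrow> pres_cong R u w"
| append: "pres_cong R u u' \<Longrightarrow> pres_cong R v v' \<Longrightarrow> pres_cong R (u @ v) (u' @ v')"

definition pres_rel :: "('g gword \<times> 'g gword) set \<Rightarrow> ('g gword \<times> 'g gword) set" where
  "pres_rel R = {(u, v). pres_cong R u v}"

definition pres_class :: "('g gword \<times> 'g gword) set \<Rightarrow> 'g gword \<Rightarrow> 'g gword set" where
  "pres_class R w = pres_rel R `` {w}"

definition presented_group :: "('g gword \<times> 'g gword) set \<Rightarrow> 'g gword set monoid" where
  "presented_group R =
    \<lparr> carrier = UNIV // pres_rel R,
      monoid.mult = (\<lambda>X Y. \<Union>u\<in>X. \<Union>v\<in>Y. pres_class R (u @ v)),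
      one = pres_class R [] \<rparr>"

lemma equiv_pres_rel: "equiv UNIV (pres_rel R)"
proof (rule equivI)
  show "refl (pres_rel R)"
    by (simp add: pres_rel_def refl_on_def pres_cong.refl)
  show "sym (pres_rel R)"
    by (simp add: pres_rel_def sym_def pres_cong.sym)
  show "trans (pres_rel R)"
    unfolding pres_rel_def trans_def by (blast intro: pres_cong.trans)
qed simp

lemma pres_class_eq_iff: "pres_class R u = pres_class R v \<longleftrightarrow> pres_cong R u v"
  unfolding pres_class_def using eq_equiv_class_iff[OF equiv_pres_rel, of u v R]
  by (simp add: pres_rel_def)

lemma carrier_presented_group: "carrier (presented_group R) = range (pres_class R)"
  by (auto simp: presented_group_def quotient_def pres_class_def)

lemma one_presented_group: "\<one>\<^bsub>presented_group R\<^esub> = pres_class R []"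
  by (simp add: presented_group_def)

lemma mult_presented_group:
  "pres_class R u \<otimes>\<^bsub>presented_group R\<^esub> pres_class R v = pres_class R (u @ v)"
proof -
  have self: "w \<in> pres_class R w" for w
    by (simp add: pres_class_def pres_rel_def pres_cong.refl)
  have "pres_class R (u' @ v') = pres_class R (u @ v)"
    if "u' \<in> pres_class R u" "v' \<in> pres_class R v" for u' v'
    using that unfolding pres_class_eq_iff
    by (simp add: pres_class_def pres_rel_def pres_cong.append pres_cong.sym)
  then have "(\<Union>u'\<in>pres_class R u. \<Union>v'\<in>pres_class R v. pres_class R (u' @ v')) = pres_class R (u @ v)"
    using self[of u] self[of v] by blast
  then show ?thesis
    by (simp add: presented_group_def)
qed

lemma gw_inv_cong: "pres_cong R (w @ gw_inv w) []" "pres_cong R (gw_inv w @ w) []"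
proof -
  show r: "pres_cong R (w @ gw_inv w) []" for w
  proof (induction w)
    case Nil
    then show ?case by (simp add: gw_inv_def pres_cong.refl)
  next
    case (Cons a w)
    obtain x e where a: "a = (x, e)" by (cases a)
    have "pres_cong R ([a] @ (w @ gw_inv w) @ [(x, \<not> e)]) ([a] @ [] @ [(x, \<not> e)])"
      by (intro pres_cong.append pres_cong.refl Cons.IH)
    then have "pres_cong R ((a # w) @ gw_inv (a # w)) [(x, e), (x, \<not> e)]"
      by (simp add: a gw_inv_def)
    then show ?case
      by (rule pres_cong.trans) (rule pres_cong.cancel)
  qed
  have "gw_inv (gw_inv w) = w"
    by (induction w) (auto simp: gw_inv_def)
  with r[of "gw_inv w"] show "pres_cong R (gw_inv w @ w) []" by simp
qed

theorem group_presented_group: "group (presented_group R)"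
proof (rule groupI)
  fix X assume "X \<in> carrier (presented_group R)"
  then obtain w where "X = pres_class R w" by (auto simp: carrier_presented_group)
  then have "pres_class R (gw_inv w) \<otimes>\<^bsub>presented_group R\<^esub> X = \<one>\<^bsub>presented_group R\<^esub>"
    by (simp add: mult_presented_group one_presented_group pres_class_eq_iff gw_inv_cong)
  then show "\<exists>Y\<in>carrier (presented_group R).
      Y \<otimes>\<^bsub>presented_group R\<^esub> X = \<one>\<^bsub>presented_group R\<^esub>"
    by (auto simp: carrier_presented_group)
qed (auto simp: carrier_presented_group mult_presented_group one_presented_group)

lemma presented_group_relation:
  "(u, v) \<in> R \<Longrightarrow> pres_class R u = pres_class R v"
  by (simp add: pres_class_eq_iff pres_cong.relation)

text \<open>
  The universal property (von Dyck): a family in a group that satisfies the relations induces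
  a homomorphism.
\<close>

primrec gw_eval :: "('h, 'm) monoid_scheme \<Rightarrow> ('g \<Rightarrow> 'h) \<Rightarrow> 'g gword \<Rightarrow> 'h" where
  "gw_eval H f [] = \<one>\<^bsub>H\<^esub>"
| "gw_eval H f (a # w) =
    (if snd a then f (fst a) else inv\<^bsub>H\<^esub> f (fst a)) \<otimes>\<^bsub>H\<^esub> gw_eval H f w"

theorem presented_group_universal:
  assumes H: "group H" and f: "\<And>x. f x \<in> carrier H"
    and R: "\<And>u v. (u, v) \<in> R \<Longrightarrow> gw_eval H f u = gw_eval H f v"
  obtains h where "h \<in> hom (presented_group R) H"
    and "\<And>w. h (pres_class R w) = gw_eval H f w"
proof -
  interpret H: group H by fact
  have cl [simp]: "gw_eval H f w \<in> carrier H" for w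
    by (induction w) (auto simp: f)
  have app: "gw_eval H f (u @ v) = gw_eval H f u \<otimes>\<^bsub>H\<^esub> gw_eval H f v" for u v
    by (induction u) (auto simp: f H.m_assoc)
  have cong: "gw_eval H f u = gw_eval H f v" if "pres_cong R u v" for u v
    using that by induction (auto simp: R f app)
  define h where "h X = gw_eval H f (SOME w. pres_class R w = X)" for X
  have h: "h (pres_class R w) = gw_eval H f w" for w
    unfolding h_def by (rule someI2[where a = w]) (simp_all add: pres_class_eq_iff cong)
  have "h \<in> hom (presented_group R) H"
    by (auto simp: hom_def carrier_presented_group mult_presented_group h app)
  then show thesis using h that by blast
qed


section \<open>$\mathcal{A}_1$-subgroups and $I_{\max}$\<close>

definition p_group :: "nat \<Rightarrow> ('a, 'b) monoid_scheme \<Rightarrow> bool" where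
  "p_group p G \<longleftrightarrow> group G \<and> finite (carrier G) \<and> (\<exists>k. order G = p ^ k)"

definition A1_group :: "nat \<Rightarrow> ('a, 'b) monoid_scheme \<Rightarrow> bool" where
  "A1_group p G \<longleftrightarrow> p_group p G \<and> \<not> comm_group G \<and>
    (\<forall>H. subgroup H G \<and> H \<noteq> carrier G \<longrightarrow> comm_group (G\<lparr>carrier := H\<rparr>))"

definition I_max :: "nat \<Rightarrow> ('a, 'b) monoid_scheme \<Rightarrow> nat" where
  "I_max p G =
    (THE k. p ^ k =
      Max {card (rcosets\<^bsub>G\<^esub> H) | H. subgroup H G \<and> A1_group p (G\<lparr>carrier := H\<rparr>)})"

text \<open>
  \<^const>\<open>I_max\<close> is meaningful only for finite non-abelian \<open>p\<close>-groups, so a claim on its value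
  includes that the group is one.
\<close>

definition has_I_max :: "nat \<Rightarrow> ('a, 'b) monoid_scheme \<Rightarrow> nat \<Rightarrow> bool" where
  "has_I_max p G k \<longleftrightarrow> p_group p G \<and> \<not> comm_group G \<and> I_max p G = k"


section \<open>The groups\<close>

datatype gen3 = Gen_a | Gen_b | Gen_c

definition pres3 ::
    "(gen3 gword \<Rightarrow> gen3 gword \<Rightarrow> gen3 gword \<Rightarrow> (gen3 gword \<times> gen3 gword) set)
      \<Rightarrow> gen3 gword set monoid" where
  "pres3 R = presented_group (R [(Gen_a, True)] [(Gen_b, True)] [(Gen_c, True)])"

definition grp_A1 :: "gen3 gword set monoid" where
  "grp_A1 = pres3 (\<lambda>a b c.
   {a \<up> 4 \<doteq> [], b \<up> 2 \<doteq> [], c \<up> 4 \<doteq> [],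
    gw_comm a b \<doteq> c, gw_comm c a \<doteq> c \<up> 2, gw_comm c b \<doteq> c \<up> 2})"

definition grp_A2 :: "gen3 gword set monoid" where
  "grp_A2 = pres3 (\<lambda>a b c.
   {a \<up> 4 \<doteq> [], b \<up> 4 \<doteq> [], c \<up> 2 \<doteq> a \<up> 2,
    gw_comm a b \<doteq> c, gw_comm c a \<doteq> c \<up> 2, gw_comm c b \<doteq> c \<up> 2})"

definition grp_A3 :: "gen3 gword set monoid" where
  "grp_A3 = pres3 (\<lambda>a b c.
   {a \<up> 8 \<doteq> [], b \<up> 2 \<doteq> [], c \<up> 2 \<doteq> a \<up> 4,
    gw_comm a b \<doteq> c, gw_comm c a \<doteq> c \<up> 2, gw_comm c b \<doteq> c \<up> 2})"

definition grp_B1 :: "nat \<Rightarrow> gen3 gword set monoid" where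
  "grp_B1 n = pres3 (\<lambda>a b c.
   {a \<up> (2 ^ (n + 1)) \<doteq> [], b \<up> 2 \<doteq> [], c \<up> 2 \<doteq> a \<up> (2 ^ n),
    gw_comm a b \<doteq> c, gw_comm c a \<doteq> [], gw_comm c b \<doteq> c \<up> 2})"

definition grp_B2 :: "nat \<Rightarrow> gen3 gword set monoid" where
  "grp_B2 n = pres3 (\<lambda>a b c.
   {a \<up> (2 ^ n) \<doteq> [], b \<up> 2 \<doteq> [], c \<up> 4 \<doteq> [],
    gw_comm a b \<doteq> c, gw_comm c a \<doteq> [], gw_comm c b \<doteq> c \<up> 2})"

definition grp_B3 :: "nat \<Rightarrow> gen3 gword set monoid" where
  "grp_B3 n = pres3 (\<lambda>a b c.
   {a \<up> (2 ^ n) \<doteq> [], b \<up> 4 \<doteq> [], c \<up> 2 \<doteq> b \<up> 2,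
    gw_comm a b \<doteq> c, gw_comm c a \<doteq> [], gw_comm c b \<doteq> c \<up> 2})"

definition grp_C1 :: "gen3 gword set monoid" where
  "grp_C1 = pres3 (\<lambda>a b c.
   {a \<up> 8 \<doteq> [], c \<up> 2 \<doteq> a \<up> 4, a \<up> 4 \<doteq> b \<up> 4,
    gw_comm a b \<doteq> c, gw_comm c a \<doteq> [], gw_comm c b \<doteq> []})"

definition grp_C2 :: "gen3 gword set monoid" where
  "grp_C2 = pres3 (\<lambda>a b c.
   {a \<up> 8 \<doteq> [], b \<up> 4 \<doteq> [], c \<up> 2 \<doteq> a \<up> 4,
    gw_comm a b \<doteq> c, gw_comm c a \<doteq> [], gw_comm c b \<doteq> []})"

definition grp_C3 :: "gen3 gword set monoid" where
  "grp_C3 = pres3 (\<lambda>a b c.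
   {a \<up> 8 \<doteq> [], c \<up> 2 \<doteq> a \<up> 4, a \<up> 4 \<doteq> b \<up> 4,
    gw_comm a b \<doteq> c, gw_comm c a \<doteq> [], gw_comm c b \<doteq> c \<up> 2})"

definition grp_C4 :: "gen3 gword set monoid" where
  "grp_C4 = pres3 (\<lambda>a b c.
   {a \<up> 8 \<doteq> [], b \<up> 4 \<doteq> [], c \<up> 2 \<doteq> a \<up> 4,
    gw_comm a b \<doteq> c, gw_comm c a \<doteq> [], gw_comm c b \<doteq> c \<up> 2})"

definition grp_C5 :: "gen3 gword set monoid" where
  "grp_C5 = pres3 (\<lambda>a b c.
   {a \<up> 8 \<doteq> [], b \<up> 4 \<doteq> [], c \<up> 2 \<doteq> a \<up> 4,
    gw_comm a b \<doteq> c, gw_comm c a \<doteq> c \<up> 2, gw_comm c b \<doteq> []})"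

text \<open>
  The parameter \<open>t\<close> of \<open>grp_D1\<close>, \<open>grp_E1\<close> and \<open>grp_E5\<close> is an element of $F_p^*$, given by its
  representative in \<open>{1..<p}\<close>; \<open>c\<close> has order dividing $p^2$, so $c^{tp}$ depends only on the
  residue class of \<open>t\<close>.
\<close>

definition grp_D1 :: "nat \<Rightarrow> nat \<Rightarrow> nat \<Rightarrow> gen3 gword set monoid" where
  "grp_D1 p n t = pres3 (\<lambda>a b c.
   {a \<up> (p ^ (n + 1)) \<doteq> [], b \<up> (p ^ n) \<doteq> [], c \<up> p \<doteq> a \<up> (p ^ n),
    gw_comm a b \<doteq> c, gw_comm c a \<doteq> [], gw_comm c b \<doteq> c \<up> (t * p)})"

definition grp_D2 :: "nat \<Rightarrow> nat \<Rightarrow> gen3 gword set monoid" where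
  "grp_D2 p n = pres3 (\<lambda>a b c.
   {a \<up> (p ^ (n + 1)) \<doteq> [], b \<up> (p ^ n) \<doteq> [], c \<up> p \<doteq> a \<up> (p ^ n),
    gw_comm a b \<doteq> c, gw_comm c a \<doteq> c \<up> p, gw_comm c b \<doteq> []})"

definition grp_D3 :: "nat \<Rightarrow> nat \<Rightarrow> gen3 gword set monoid" where
  "grp_D3 p n = pres3 (\<lambda>a b c.
   {a \<up> (p ^ (n + 1)) \<doteq> [], b \<up> (p ^ n) \<doteq> [], c \<up> p \<doteq> a \<up> (p ^ n),
    gw_comm a b \<doteq> c, gw_comm c a \<doteq> [], gw_comm c b \<doteq> []})"

definition grp_D4 :: "nat \<Rightarrow> nat \<Rightarrow> gen3 gword set monoid" where
  "grp_D4 p n = pres3 (\<lambda>a b c.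
   {a \<up> (p ^ n) \<doteq> [], b \<up> (p ^ n) \<doteq> [], c \<up> (p ^ 2) \<doteq> [],
    gw_comm a b \<doteq> c, gw_comm c a \<doteq> c \<up> p, gw_comm c b \<doteq> []})"

definition grp_D5 :: "nat \<Rightarrow> nat \<Rightarrow> gen3 gword set monoid" where
  "grp_D5 p n = pres3 (\<lambda>a b c.
   {a \<up> (p ^ n) \<doteq> [], b \<up> (p ^ n) \<doteq> [], c \<up> (p ^ 2) \<doteq> [],
    gw_comm a b \<doteq> c, gw_comm c a \<doteq> [], gw_comm c b \<doteq> []})"

definition grp_E1 :: "nat \<Rightarrow> nat \<Rightarrow> nat \<Rightarrow> nat \<Rightarrow> gen3 gword set monoid" where
  "grp_E1 p n m t = pres3 (\<lambda>a b c.
   {a \<up> (p ^ (n + 1)) \<doteq> [], b \<up> (p ^ m) \<doteq> [], c \<up> p \<doteq> a \<up> (p ^ n),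
    gw_comm a b \<doteq> c, gw_comm c a \<doteq> [], gw_comm c b \<doteq> c \<up> (t * p)})"

definition grp_E2 :: "nat \<Rightarrow> nat \<Rightarrow> nat \<Rightarrow> gen3 gword set monoid" where
  "grp_E2 p n m = pres3 (\<lambda>a b c.
   {a \<up> (p ^ (n + 1)) \<doteq> [], b \<up> (p ^ m) \<doteq> [], c \<up> p \<doteq> a \<up> (p ^ n),
    gw_comm a b \<doteq> c, gw_comm c a \<doteq> c \<up> p, gw_comm c b \<doteq> []})"

definition grp_E3 :: "nat \<Rightarrow> nat \<Rightarrow> nat \<Rightarrow> gen3 gword set monoid" where
  "grp_E3 p n m = pres3 (\<lambda>a b c.
   {a \<up> (p ^ (n + 1)) \<doteq> [], b \<up> (p ^ m) \<doteq> [], c \<up> p \<doteq> a \<up> (p ^ n),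
    gw_comm a b \<doteq> c, gw_comm c a \<doteq> [], gw_comm c b \<doteq> []})"

definition grp_E4 :: "nat \<Rightarrow> nat \<Rightarrow> nat \<Rightarrow> gen3 gword set monoid" where
  "grp_E4 p n m = pres3 (\<lambda>a b c.
   {a \<up> (p ^ n) \<doteq> [], b \<up> (p ^ (m + 1)) \<doteq> [], c \<up> p \<doteq> b \<up> (p ^ m),
    gw_comm a b \<doteq> c, gw_comm c a \<doteq> [], gw_comm c b \<doteq> c \<up> p})"

definition grp_E5 :: "nat \<Rightarrow> nat \<Rightarrow> nat \<Rightarrow> nat \<Rightarrow> gen3 gword set monoid" where
  "grp_E5 p n m t = pres3 (\<lambda>a b c.
   {a \<up> (p ^ n) \<doteq> [], b \<up> (p ^ (m + 1)) \<doteq> [], c \<up> p \<doteq> b \<up> (p ^ m),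
    gw_comm a b \<doteq> c, gw_comm c a \<doteq> c \<up> (t * p), gw_comm c b \<doteq> []})"

definition grp_E6 :: "nat \<Rightarrow> nat \<Rightarrow> nat \<Rightarrow> gen3 gword set monoid" where
  "grp_E6 p n m = pres3 (\<lambda>a b c.
   {a \<up> (p ^ n) \<doteq> [], b \<up> (p ^ (m + 1)) \<doteq> [], c \<up> p \<doteq> b \<up> (p ^ m),
    gw_comm a b \<doteq> c, gw_comm c a \<doteq> [], gw_comm c b \<doteq> []})"

definition grp_E7 :: "nat \<Rightarrow> nat \<Rightarrow> nat \<Rightarrow> gen3 gword set monoid" where
  "grp_E7 p n m = pres3 (\<lambda>a b c.
   {a \<up> (p ^ n) \<doteq> [], b \<up> (p ^ m) \<doteq> [], c \<up> (p ^ 2) \<doteq> [],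
    gw_comm a b \<doteq> c, gw_comm c a \<doteq> [], gw_comm c b \<doteq> c \<up> p})"

definition grp_E8 :: "nat \<Rightarrow> nat \<Rightarrow> nat \<Rightarrow> gen3 gword set monoid" where
  "grp_E8 p n m = pres3 (\<lambda>a b c.
   {a \<up> (p ^ n) \<doteq> [], b \<up> (p ^ m) \<doteq> [], c \<up> (p ^ 2) \<doteq> [],
    gw_comm a b \<doteq> c, gw_comm c a \<doteq> c \<up> p, gw_comm c b \<doteq> []})"

definition grp_E9 :: "nat \<Rightarrow> nat \<Rightarrow> nat \<Rightarrow> gen3 gword set monoid" where
  "grp_E9 p n m = pres3 (\<lambda>a b c.
   {a \<up> (p ^ n) \<doteq> [], b \<up> (p ^ m) \<doteq> [], c \<up> (p ^ 2) \<doteq> [],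
    gw_comm a b \<doteq> c, gw_comm c a \<doteq> [], gw_comm c b \<doteq> []})"

end

theory Submission
  imports Defs
begin

text \<open>
  Every non-abelian \<open>p\<close>-group contains an $\mathcal{A}_1$-subgroup, so $p^{I_{\max}}$ is the index of a
  non-abelian subgroup of least order. All groups in question belong to one family: generators
  \<open>a, b, c\<close> with $c^{p^2} = 1$, $a^{p^N} = c^{rp}$, $b^{p^M} = c^{sp}$, $[a,b] = c$, $[c,a] = c^{ip}$,
  $[c,b] = c^{jp}$, and order $p^{N+M+2}$. Let \<open>H\<close> be a non-abelian subgroup; it contains $c^p$.

  If two elements of \<open>H\<close> have exponent vectors with respect to \<open>a, b\<close> whose determinant is nonzero
  modulo $p^2$, then $H\langle c\rangle$ contains $\langle a^p, b^p, c\rangle$ properly, whence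
  $|H| \ge p^{N+M}$. In class two (\<open>i = j = 0\<close>) non-commuting elements always have such a determinant,
  and $\langle a, b^p, c^p\rangle$ attains the bound.

  If $i = 0 \ne j$, non-commuting elements with determinant zero modulo $p^2$ cannot both lie in
  $\langle a, b^p, c\rangle$. Then \<open>H\<close> maps onto the cyclic group $G/\langle a, c\rangle$ of order $p^M$,
  and the kernel of this map has order at least $p^2$, for otherwise it would be the central
  subgroup $\langle c^p\rangle$ and \<open>H\<close> would be abelian. So $|H| \ge p^{M+2}$, attained by
  $\langle b, c\rangle$. The case $j = 0 \ne i$ is symmetric. For the groups (A), where \<open>i = j = 1\<close>,
  a non-abelian subgroup of order 8 exists, and no group of smaller 2-power order is non-abelian.
\<close>

section \<open>Non-abelian subgroups of least order\<close>

definition noncommuting :: "('a, 'm) monoid_scheme \<Rightarrow> 'a set \<Rightarrow> bool" where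
  "noncommuting G H \<longleftrightarrow> (\<exists>u\<in>H. \<exists>v\<in>H. u \<otimes>\<^bsub>G\<^esub> v \<noteq> v \<otimes>\<^bsub>G\<^esub> u)"

lemma (in group) comm_group_subgroup_iff:
  assumes "subgroup H G"
  shows "comm_group (G\<lparr>carrier := H\<rparr>) \<longleftrightarrow> \<not> noncommuting G H"
proof
  assume "comm_group (G\<lparr>carrier := H\<rparr>)"
  then interpret H: comm_group "G\<lparr>carrier := H\<rparr>" .
  show "\<not> noncommuting G H"
    using H.m_comm by (auto simp: noncommuting_def)
next
  assume *: "\<not> noncommuting G H"
  show "comm_group (G\<lparr>carrier := H\<rparr>)"
    by (rule group.group_comm_groupI[OF subgroup_imp_group[OF assms]])
       (use * in \<open>auto simp: noncommuting_def\<close>)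
qed

lemma (in group) card_subgroup_prime_power:
  assumes "prime p" "order G = p ^ n" "subgroup H G"
  shows "\<exists>k\<le>n. card H = p ^ k"
proof -
  have "card H dvd p ^ n"
    using lagrange[OF assms(3)] assms(2) by (metis dvd_triv_right)
  then show ?thesis
    using divides_primepow_nat[OF assms(1)] by blast
qed

text \<open>Proper subgroups of \<open>H0\<close> are too small to be non-abelian, so
  \<open>H0\<close> is itself an A1-subgroup; by Lagrange the least order p^l gives the largest
  index p^k. This trades a maximum over A1-subgroups for a minimum over all non-abelian
  subgroups.\<close>

lemma (in group) has_I_maxI:
  assumes p: "prime p" and ord: "order G = p ^ (k + l)"
    and H0: "subgroup H0 G" "card H0 = p ^ l" "noncommuting G H0"
    and min: "\<And>H. subgroup H G \<Longrightarrow> noncommuting G H \<Longrightarrow> p ^ l \<le> card H"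
  shows "has_I_max p G k"
proof -
  have p1: "p > 1" using p prime_gt_1_nat by blast
  have fin: "finite (carrier G)"
    using ord p1 by (metis order_gt_0_iff_finite zero_less_power less_trans zero_less_one)
  have index: "card (rcosets H) * card H = p ^ (k + l)" if "subgroup H G" for H
    using lagrange[OF that] ord by simp
  have G: "p_group p G"
    using fin ord is_group by (auto simp: p_group_def)
  have nc: "\<not> comm_group G"
  proof
    assume "comm_group G"
    then interpret comm_group G .
    show False
      using H0(1,3) m_comm by (auto simp: noncommuting_def dest: subgroup.mem_carrier)
  qed
  have A1: "A1_group p (G\<lparr>carrier := H0\<rparr>)"
    unfolding A1_group_def
  proof (intro conjI allI impI)
    show "p_group p (G\<lparr>carrier := H0\<rparr>)"
      using subgroup_imp_group[OF H0(1)] H0(2) finite_subset[OF subgroup.subset[OF H0(1)] fin]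
      by (auto simp: p_group_def order_def)
    show "\<not> comm_group (G\<lparr>carrier := H0\<rparr>)"
      using comm_group_subgroup_iff H0 by blast
    fix H assume H: "subgroup H (G\<lparr>carrier := H0\<rparr>) \<and> H \<noteq> carrier (G\<lparr>carrier := H0\<rparr>)"
    then have sub: "subgroup H G"
      using incl_subgroup H0(1) by blast
    have "H \<subset> H0"
      using H subgroup.subset by fastforce
    then have "card H < p ^ l"
      using psubset_card_mono finite_subset[OF subgroup.subset[OF H0(1)] fin] H0(2) by metis
    then have "\<not> noncommuting G H"
      using min[OF sub] by auto
    then show "comm_group (G\<lparr>carrier := H0, carrier := H\<rparr>)"
      using comm_group_subgroup_iff[OF sub] by simp
  qed
  let ?I = "{card (rcosets H) | H. subgroup H G \<and> A1_group p (G\<lparr>carrier := H\<rparr>)}"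
  have "Max ?I = p ^ k"
  proof (rule Max_eqI)
    have "?I \<subseteq> (\<lambda>H. card (rcosets H)) ` Pow (carrier G)"
      using subgroup.subset by blast
    then show "finite ?I"
      using fin finite_subset by blast
    have "card (rcosets H0) * p ^ l = p ^ k * p ^ l"
      using index[OF H0(1)] H0(2) by (simp add: power_add)
    then show "p ^ k \<in> ?I"
      using H0(1) A1 p1 by (auto intro!: exI[of _ H0])
    fix x assume "x \<in> ?I"
    then obtain H where H: "subgroup H G" "A1_group p (G\<lparr>carrier := H\<rparr>)" "x = card (rcosets H)"
      by blast
    then have "noncommuting G H"
      using comm_group_subgroup_iff by (auto simp: A1_group_def)
    then have "x * p ^ l \<le> x * card H"
      using min[OF H(1)] by simp
    also have "\<dots> = p ^ k * p ^ l"
      using index[OF H(1)] H(3) by (simp add: power_add)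
    finally show "x \<le> p ^ k"
      using p1 by simp
  qed
  then have "I_max p G = k"
    unfolding I_max_def using p1 by (auto intro!: the_equality)
  then show ?thesis
    using G nc by (simp add: has_I_max_def)
qed

text \<open>Lets a presented group \<open>P\<close> be studied in a concrete group \<open>G\<close>:
  an isomorphism matches the non-abelian subgroups and preserves their orders.\<close>

lemma has_I_max_isoI:
  assumes P: "group P" and G: "group G" and h: "h \<in> iso P G"
    and p: "prime p" and ord: "order G = p ^ (k + l)"
    and H0: "subgroup H0 G" "card H0 = p ^ l" "noncommuting G H0"
    and min: "\<And>H. subgroup H G \<Longrightarrow> noncommuting G H \<Longrightarrow> p ^ l \<le> card H"
  shows "has_I_max p P k"
proof -
  \<comment> \<open>Stated for arbitrary groups because it is applied both ways: \<open>H0\<close>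
    is pulled back to \<open>P\<close>, and any subgroup of \<open>P\<close> is pushed forward to
    \<open>G\<close>.\<close>
  have transfer: "subgroup (f ` H) B \<and> card (f ` H) = card H \<and> noncommuting B (f ` H)"
    if "group A" "group B" and f: "f \<in> iso A B" and H: "subgroup H A" "noncommuting A H"
    for A :: "('x, 'm) monoid_scheme" and B :: "('y, 'n) monoid_scheme" and f H
  proof -
    interpret group_hom A B f
      using that by (auto simp: group_hom_def group_hom_axioms_def iso_def)
    have inj: "inj_on f (carrier A)"
      using f by (auto simp: iso_def bij_betw_def)
    have sub: "H \<subseteq> carrier A"
      using H(1) subgroup.subset by blast
    obtain u v where uv: "u \<in> H" "v \<in> H" "u \<otimes>\<^bsub>A\<^esub> v \<noteq> v \<otimes>\<^bsub>A\<^esub> u"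
      using H(2) by (auto simp: noncommuting_def)
    then have "f (u \<otimes>\<^bsub>A\<^esub> v) \<noteq> f (v \<otimes>\<^bsub>A\<^esub> u)"
      using inj sub by (meson G.m_closed inj_onD subsetD)
    then have "noncommuting B (f ` H)"
      using uv sub by (auto simp: noncommuting_def subset_eq)
    then show ?thesis
      using subgroup_img_is_subgroup[OF H(1)] card_image[OF inj_on_subset[OF inj sub]] by blast
  qed
  have g: "inv_into (carrier P) h \<in> iso G P"
    using group.iso_set_sym[OF P h] .
  have "order P = order G"
    using h bij_betw_same_card by (auto simp: iso_def order_def)
  then show ?thesis
    using group.has_I_maxI[OF P p, of k l "inv_into (carrier P) h ` H0"] ord
      transfer[OF G P g H0(1,3)] H0(2) transfer[OF P G h] min by metis
qed

text \<open>Here \<open>\<chi>\<close> is a homomorphism to the integers modulo p^L, written in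
  least residues, and \<open>h\<close> maps to a generator. If the kernel on \<open>H\<close> were
  only the central \<open>Z\<close>, then H = <h> Z would be abelian; so the kernel has order at
  least p^2.\<close>

lemma (in group) card_ge_if_cyclic_projection:
  fixes \<chi> :: "'a \<Rightarrow> int" and p L n :: nat
  assumes p: "prime p" and ord: "order G = p ^ n"
    and range: "\<And>u. u \<in> carrier G \<Longrightarrow> \<chi> u \<in> {0..<int p ^ L}"
    and mult: "\<And>u v. u \<in> carrier G \<Longrightarrow> v \<in> carrier G \<Longrightarrow> \<chi> (u \<otimes> v) = (\<chi> u + \<chi> v) mod int p ^ L"
    and H: "subgroup H G" "noncommuting G H"
    and h: "h \<in> H" "coprime (\<chi> h) (int p)"
    and Z: "Z \<subseteq> H" "card Z = p" "\<And>z. z \<in> Z \<Longrightarrow> \<chi> z = 0"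
    and central: "\<And>z u. z \<in> Z \<Longrightarrow> u \<in> carrier G \<Longrightarrow> z \<otimes> u = u \<otimes> z"
  shows "p ^ (L + 2) \<le> card H"
proof -
  let ?q = "int p ^ L"
  interpret H: subgroup H G by fact
  have p1: "p > 1" using p prime_gt_1_nat by blast
  then have q0: "?q > 0" by simp
  have fin: "finite H"
    using ord p1 H.subset finite_subset by (metis order_gt_0_iff_finite zero_less_power less_trans zero_less_one)
  have fix0: "\<chi> v = 0" if "u \<in> carrier G" "v \<in> carrier G" "\<chi> (u \<otimes> v) = \<chi> u" for u v
  proof -
    have "(\<chi> u + \<chi> v) mod ?q = \<chi> u mod ?q"
      using mult[of u v] that range[of u] by simp
    then have "?q dvd \<chi> v"
      by (simp add: mod_eq_dvd_iff)
    then show ?thesis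
      using range[OF that(2)] zdvd_not_zless[of "\<chi> v" ?q] by force
  qed
  have one: "\<chi> \<one> = 0" by (rule fix0[of \<one>]) auto
  have pow: "\<chi> (h [^] (k::nat)) = (int k * \<chi> h) mod ?q" for k
    by (induction k) (use h(1) one in \<open>simp_all add: mult mod_simps algebra_simps\<close>)
  \<comment> \<open>\<open>a\<close> inverts \<open>\<chi> h\<close> modulo p^L, so the power of
    \<open>h\<close> with exponent \<open>t * a\<close> maps to \<open>t\<close>.\<close>
  obtain a b where ab: "a * \<chi> h + b * ?q = 1"
    using h(2) bezout_int[of "\<chi> h" ?q] by (metis coprime_imp_gcd_eq_1 coprime_power_right_iff)
  have surj: "\<exists>k::nat. \<chi> (h [^] k) = t" if t: "t \<in> {0..<?q}" for t
  proof -
    have "t * a * \<chi> h + t * b * ?q = t"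
      using ab by (metis distrib_left mult.assoc mult.right_neutral)
    then have "(t * a * \<chi> h) mod ?q = t mod ?q"
      by (metis mod_mult_self1)
    moreover have "int (nat (t * a mod ?q)) = t * a mod ?q"
      using q0 by simp
    ultimately have "\<chi> (h [^] nat (t * a mod ?q)) = t"
      using t unfolding pow by (simp add: mod_simps)
    then show ?thesis by blast
  qed
  define K where "K = {u \<in> H. \<chi> u = 0}"
  have decomp: "inv (h [^] k) \<otimes> u \<in> K" if u: "u \<in> H" and "\<chi> (h [^] k) = \<chi> u" for u and k :: nat
  proof -
    let ?w = "inv (h [^] k) \<otimes> u"
    have hk: "h [^] k \<in> H" using h(1) nat_pow_closed by (induction k) auto
    then have "?w \<in> H" using u by auto
    moreover have "h [^] k \<otimes> ?w = u"
      using hk u by (simp add: m_assoc[symmetric])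
    ultimately show ?thesis
      using fix0[of "h [^] k" ?w] that hk by (simp add: K_def)
  qed
  have Ksub: "subgroup K G"
  proof (rule subgroupI)
    show "K \<subseteq> carrier G" "K \<noteq> {}"
      using one by (auto simp: K_def intro!: exI[of _ "\<one>"])
    fix u assume u: "u \<in> K"
    then show "inv u \<in> K"
      using fix0[of u "inv u"] one by (auto simp: K_def)
    fix v assume "v \<in> K"
    then show "u \<otimes> v \<in> K"
      using u by (auto simp: K_def mult)
  qed
  obtain k where k: "card K = p ^ k"
    using card_subgroup_prime_power[OF p ord Ksub] by blast
  have finK: "finite K" using fin by (simp add: K_def)
  have "k \<ge> 2"
  proof (rule ccontr)
    assume "\<not> k \<ge> 2"
    then have "card K \<le> p ^ 1"
      unfolding k using p1 by (intro power_increasing) auto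
    moreover have "Z \<subseteq> K" using Z by (auto simp: K_def)
    ultimately have K: "K = Z"
      using card_seteq[OF finK] Z(2) by auto
    have "u \<otimes> v = v \<otimes> u" if uv: "u \<in> H" "v \<in> H" for u v
    proof -
      obtain k l :: nat where kl: "\<chi> (h [^] k) = \<chi> u" "\<chi> (h [^] l) = \<chi> v"
        using surj range uv by (meson H.mem_carrier)
      define w where "w = inv (h [^] k) \<otimes> u"
      define x where "x = inv (h [^] l) \<otimes> v"
      have hc: "h \<in> carrier G" using h(1) by simp
      have wx: "w \<in> Z" "x \<in> Z"
        using decomp uv kl K by (auto simp: w_def x_def)
      then have c: "w \<in> carrier G" "x \<in> carrier G"
        using Z(1) H.subset by auto
      have u: "u = h [^] k \<otimes> w" and v: "v = h [^] l \<otimes> x"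
        using uv hc by (simp_all add: w_def x_def m_assoc[symmetric])
      have "h [^] k \<otimes> h [^] l = h [^] l \<otimes> h [^] k"
        using hc by (simp add: nat_pow_mult add.commute)
      then show ?thesis
        unfolding u v using c hc central[OF wx(1)] central[OF wx(2)]
        by (smt (verit) m_assoc m_closed nat_pow_closed)
    qed
    then show False using H(2) by (auto simp: noncommuting_def)
  qed
  \<comment> \<open>\<open>\<kappa>\<close> picks a power of \<open>h\<close> over each residue;
    multiplied by \<open>K\<close>, these powers give p^L |K| distinct elements of
    \<open>H\<close>.\<close>
  define \<kappa> where "\<kappa> t = (SOME k::nat. \<chi> (h [^] k) = t)" for t
  have \<kappa>: "\<chi> (h [^] \<kappa> t) = t" if "t \<in> {0..<?q}" for t
    unfolding \<kappa>_def using someI_ex[OF surj[OF that]] .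
  have hk: "h [^] k \<in> H" for k :: nat
    using h(1) by (induction k) auto
  let ?f = "\<lambda>(t, w). h [^] \<kappa> t \<otimes> w"
  have "inj_on ?f ({0..<?q} \<times> K)"
  proof (rule inj_onI; clarify)
    fix t w t' w'
    assume t: "t \<in> {0..<?q}" "t' \<in> {0..<?q}" and w: "w \<in> K" "w' \<in> K"
      and eq: "h [^] \<kappa> t \<otimes> w = h [^] \<kappa> t' \<otimes> w'"
    have "\<chi> (h [^] \<kappa> t \<otimes> w) = t" if "t \<in> {0..<?q}" "w \<in> K" for t w
      using that hk \<kappa>[OF that(1)] by (simp add: mult K_def)
    then have "t = t'" using t w eq by metis
    then show "t = t' \<and> w = w'"
      using eq w hk by (simp add: K_def)
  qed
  then have "card ({0..<?q} \<times> K) \<le> card H"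
    by (rule card_inj_on_le) (use fin hk in \<open>auto simp: K_def\<close>)
  then have "p ^ L * p ^ k \<le> card H"
    by (simp add: card_cartesian_product k nat_power_eq)
  moreover have "p ^ (L + 2) \<le> p ^ L * p ^ k"
    unfolding power_add[symmetric] using p1 \<open>k \<ge> 2\<close> by (intro power_increasing) auto
  ultimately show ?thesis by linarith
qed

section \<open>A model on triples\<close>

text \<open>For x >= 0 this agrees modulo p^2 with the sum of (1 + k p)^l over l < x. With
  \<open>k = i\<close> it is the exponent of c that arises when (a c)^x is collected into a^x times
  a power of c, which is needed because a^x b = b (a c)^x.\<close>

definition qd :: "nat \<Rightarrow> nat \<Rightarrow> int \<Rightarrow> int" where
  "qd p k x = x + int k * int p * (x * (x - 1) div 2)"

lemma qd_0 [simp]: "qd p k 0 = 0" and qd_1 [simp]: "qd p k 1 = 1"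
  by (simp_all add: qd_def)

lemma half_prod: "2 * (x * (x - 1) div 2) = x * (x - 1)" for x :: int
  by simp

lemma qd_add: "qd p k (x + y) = qd p k x + qd p k y + int k * int p * x * y"
proof -
  have "2 * ((x + y) * (x + y - 1) div 2) = 2 * (x * (x - 1) div 2 + y * (y - 1) div 2 + x * y)"
    by (simp only: half_prod distrib_left) (simp add: algebra_simps)
  then have "(x + y) * (x + y - 1) div 2 = x * (x - 1) div 2 + y * (y - 1) div 2 + x * y"
    by (simp only: mult_cancel_left) simp
  then show ?thesis
    by (simp only: qd_def) (simp add: algebra_simps)
qed

lemma odd_prime_dvd_half_prod:
  fixes x :: int
  assumes "prime p" "p \<noteq> 2" "int p dvd x"
  shows "int p dvd x * (x - 1) div 2"
proof -
  have "coprime (int p) 2"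
    using assms(1,2) by (metis coprime_int_iff coprime_right_2_iff_odd int_ops(3) of_nat_numeral
        prime_odd_nat prime_ge_2_nat le_neq_implies_less)
  moreover have "int p dvd 2 * (x * (x - 1) div 2)"
    unfolding half_prod using assms(3) by simp
  ultimately show ?thesis
    using coprime_dvd_mult_right_iff by blast
qed

text \<open>For N >= 2 the argument is divisible by p^2 and its binomial coefficient by p. For p = 2
  and N = 1 the value is 4 k l^2 + 2 l (1 - k), a multiple of 4 for odd \<open>k\<close>.\<close>

lemma qd_period:
  assumes p: "prime p" and "N \<ge> 2 \<or> N = 1 \<and> p = 2 \<and> odd k"
  shows "int p * int p dvd qd p k (int p ^ N * l)"
  using assms(2)
proof
  assume "N \<ge> 2"
  then obtain t where t: "int p ^ N * l = int p * int p * t"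
    by (metis dvd_def dvd_mult2 le_imp_power_dvd power2_eq_square)
  let ?x = "int p * int p * t"
  have "int p dvd ?x * (?x - 1) div 2"
  proof (cases "p = 2")
    case True
    have "?x * (?x - 1) = 2 * (int p * t * (?x - 1))" using True by simp
    then have "?x * (?x - 1) div 2 = int p * t * (?x - 1)" by linarith
    then show ?thesis by simp
  next
    case False
    then show ?thesis
      using odd_prime_dvd_half_prod[OF p, of ?x] by simp
  qed
  then show ?thesis
    unfolding t qd_def by (auto intro!: dvd_add simp: mult_dvd_mono dvd_mult2 mult.assoc)
next
  assume "N = 1 \<and> p = 2 \<and> odd k"
  then obtain m where *: "N = 1" "p = 2" "k = 2 * m + 1" by (auto elim: oddE)
  have "(2 * l) * (2 * l - 1) div 2 = l * (2 * l - 1)" by simp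
  then have "qd p k (int p ^ N * l) = 4 * (l * l + int m * (l * (2 * l - 1)))"
    unfolding qd_def * by (simp add: algebra_simps)
  then show ?thesis using * by simp
qed

text \<open>
  The conditions on \<open>N\<close> and \<open>M\<close> make $[a^{p^N}, b]$ and $[a, b^{p^M}]$ trivial, as is necessary for
  $a^{p^N}$ and $b^{p^M}$ to be powers of the central element $c^p$.
\<close>

locale triples =
  fixes p N M r s i j :: nat
  assumes p: "prime p"
    and N: "N \<ge> 2 \<or> N = 1 \<and> p = 2 \<and> odd i"
    and M: "M \<ge> 2 \<or> M = 1 \<and> p = 2 \<and> odd j"
begin

abbreviation "A \<equiv> int p ^ N"
abbreviation "B \<equiv> int p ^ M"
abbreviation "Q \<equiv> int p * int p"

text \<open>
  The triple \<open>(y, x, z)\<close> stands for $b^y a^x c^z$. The product is read off from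
  $a^x b^y = b^y a^x c^{e_i(x) e_j(y)}$ with $e_k(x) = x + kp\binom{x}{2}$ (here \<^const>\<open>qd\<close>) and from
  $c^z a^x = a^x c^{z(1+ipx)}$, $c^z b^y = b^y c^{z(1+jpy)}$, exponents of \<open>c\<close> being taken modulo $p^2$.
  The map \<open>nrm\<close> carries $b^{p^M} = c^{sp}$ and $a^{p^N} = c^{rp}$ into the last coordinate.
\<close>

fun zc :: "int \<times> int \<times> int \<Rightarrow> int \<times> int \<times> int \<Rightarrow> int" where
  "zc (y, x, z) (y', x', z') =
    z' + (1 + int i * int p * x') * (qd p i x * qd p j y' + z * (1 + int j * int p * y'))"

fun star :: "int \<times> int \<times> int \<Rightarrow> int \<times> int \<times> int \<Rightarrow> int \<times> int \<times> int" where
  "star (y, x, z) (y', x', z') = (y + y', x + x', zc (y, x, z) (y', x', z'))"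

fun nrm :: "int \<times> int \<times> int \<Rightarrow> int \<times> int \<times> int" where
  "nrm (y, x, z) = (y mod B, x mod A, (z + int p * (int s * (y div B) + int r * (x div A))) mod Q)"

definition T :: "(int \<times> int \<times> int) monoid" where
  "T = \<lparr>carrier = {0..<B} \<times> {0..<A} \<times> {0..<Q}, monoid.mult = (\<lambda>u v. nrm (star u v)), one = (0, 0, 0)\<rparr>"

lemma p_gt_1: "p > 1" using p prime_gt_1_nat by blast

lemma pos: "A > 0" "B > 0" "Q > 0" using p_gt_1 by auto

lemma N_ge_1: "N \<ge> 1" and M_ge_1: "M \<ge> 1" using N M by auto

lemma p_dvd_A: "int p dvd A" and p_dvd_B: "int p dvd B"
  using N_ge_1 M_ge_1 by (simp_all add: dvd_power)

lemma nrm_id: "u \<in> carrier T \<Longrightarrow> nrm u = u"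
  by (auto simp: T_def)

lemma nrm_closed: "nrm u \<in> carrier T"
  using pos by (cases u) (auto simp: T_def)

text \<open>Shifting by whole periods raises the quotients by \<open>k\<close> and \<open>l\<close>,
  and \<open>nrm\<close> charges p (s k + r l) for this to the last coordinate. With
  \<open>k = l = 0\<close> it just compares last coordinates modulo p^2.\<close>

lemma nrm_shift:
  assumes "Q dvd z + int p * (int s * k + int r * l) - z'"
  shows "nrm (y + B * k, x + A * l, z) = nrm (y, x, z')"
proof -
  have "(y + B * k) div B = y div B + k" "(x + A * l) div A = x div A + l"
    using pos by (simp_all add: add.commute)
  moreover have "(z + int p * (int s * (y div B + k) + int r * (x div A + l))) mod Q
      = (z' + int p * (int s * (y div B) + int r * (x div A))) mod Q"
    using assms by (simp add: mod_eq_dvd_iff algebra_simps)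
  ultimately show ?thesis by simp
qed

text \<open>Inner occurrences of \<open>nrm\<close> can thus be dropped, which reduces the group
  axioms to congruences modulo p^2 for \<open>zc\<close>. Each is proved by exhibiting the cofactor
  of \<open>Q\<close>.\<close>

lemma nrm_star_left: "nrm (star (nrm u) v) = nrm (star u v)"
proof -
  obtain y x z y' x' z' where u: "u = (y, x, z)" and v: "v = (y', x', z')"
    by (cases u; cases v) auto
  define k where "k = - (y div B)"
  define l where "l = - (x div A)"
  define m where "m = (z + int p * (int s * (y div B) + int r * (x div A))) div Q"
  have y: "y mod B = y + B * k" and x: "x mod A = x + A * l"
    by (simp_all add: k_def l_def minus_div_mult_eq_mod[symmetric])
  have z: "(z + int p * (int s * (y div B) + int r * (x div A))) mod Q
      = z - int p * (int s * k + int r * l) - Q * m"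
    unfolding m_def minus_mult_div_eq_mod[symmetric] by (simp add: k_def l_def algebra_simps)
  obtain e where e: "qd p i (A * l) = Q * e"
    using qd_period[OF p N] by (auto elim: dvdE)
  obtain n where n: "A = int p * n" using p_dvd_A by (auto elim: dvdE)
  \<comment> \<open>The cross term of \<open>qd_add\<close> contains p A, a multiple of p^2.\<close>
  have e': "qd p i (x + A * l) = qd p i x + Q * (e + int i * x * n * l)"
    unfolding qd_add e by (simp add: n algebra_simps)
  have "zc (y + B * k, x + A * l, z - int p * (int s * k + int r * l) - Q * m) v
      + int p * (int s * k + int r * l) - zc u v
      = Q * ((1 + int i * int p * x') * (e + int i * x * n * l) * qd p j y'
        - (1 + int i * int p * x') * (1 + int j * int p * y') * m
        - (int s * k + int r * l) * (int i * x' + int j * y' + int i * int j * int p * x' * y'))"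
    unfolding u v zc.simps e' by (simp add: algebra_simps)
  then have "Q dvd zc (y + B * k, x + A * l, z - int p * (int s * k + int r * l) - Q * m) v
      + int p * (int s * k + int r * l) - zc u v"
    by (metis dvd_triv_left)
  from nrm_shift[OF this, of "y + y'" "x + x'"] show ?thesis
    unfolding u nrm.simps y x z by (simp add: v algebra_simps)
qed

lemma nrm_star_right: "nrm (star u (nrm v)) = nrm (star u v)"
proof -
  obtain y x z y' x' z' where u: "u = (y, x, z)" and v: "v = (y', x', z')"
    by (cases u; cases v) auto
  define k where "k = - (y' div B)"
  define l where "l = - (x' div A)"
  define m where "m = (z' + int p * (int s * (y' div B) + int r * (x' div A))) div Q"
  have y: "y' mod B = y' + B * k" and x: "x' mod A = x' + A * l"
    by (simp_all add: k_def l_def minus_div_mult_eq_mod[symmetric])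
  have z: "(z' + int p * (int s * (y' div B) + int r * (x' div A))) mod Q
      = z' - int p * (int s * k + int r * l) - Q * m"
    unfolding m_def minus_mult_div_eq_mod[symmetric] by (simp add: k_def l_def algebra_simps)
  obtain e where e: "qd p j (B * k) = Q * e"
    using qd_period[OF p M] by (auto elim: dvdE)
  \<comment> \<open>Here the reduced exponents also occur in the factors 1 + i p x' and 1 + j p y',
    which change by multiples of p A and p B.\<close>
  obtain n where n: "A = int p * n" using p_dvd_A by (auto elim: dvdE)
  obtain n' where n': "B = int p * n'" using p_dvd_B by (auto elim: dvdE)
  have e': "qd p j (y' + B * k) = qd p j y' + Q * (e + int j * y' * n' * k)"
    unfolding qd_add e by (simp add: n' algebra_simps)
  have "zc u (y' + B * k, x' + A * l, z' - int p * (int s * k + int r * l) - Q * m)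
      + int p * (int s * k + int r * l) - zc u v
      = Q * (int i * n * l * (qd p i x * qd p j (y' + B * k) + z * (1 + int j * int p * (y' + B * k)))
        + (1 + int i * int p * x') * (qd p i x * (e + int j * y' * n' * k) + z * int j * n' * k) - m)"
    unfolding u v zc.simps e' by (simp add: n n' algebra_simps)
  then have "Q dvd zc u (y' + B * k, x' + A * l, z' - int p * (int s * k + int r * l) - Q * m)
      + int p * (int s * k + int r * l) - zc u v"
    by (metis dvd_triv_left)
  from nrm_shift[OF this, of "y + y'" "x + x'"] show ?thesis
    unfolding v nrm.simps y x z by (simp add: u algebra_simps)
qed

text \<open>\<open>star\<close> adds the first two coordinates exactly, so only \<open>zc\<close>
  has to be compared; there 1 + i p x turns sums into products modulo p^2.\<close>

lemma nrm_star_assoc: "nrm (star (star u v) w) = nrm (star u (star v w))"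
proof -
  obtain y x z y' x' z' y'' x'' z'' where
    u: "u = (y, x, z)" and v: "v = (y', x', z')" and w: "w = (y'', x'', z'')"
    by (cases u; cases v; cases w) auto
  \<comment> \<open>Naming the halved product makes the remaining identity polynomial.\<close>
  define h where "h x = x * (x - 1) div 2" for x :: int
  have E: "qd p k x = x + int k * int p * h x" for k x
    by (simp add: qd_def h_def)
  have "zc (star u v) w - zc u (star v w)
      = Q * (int i * int i * (x * x' * x'' * qd p j y'' - x' * h x * qd p j y''
            + x' * x'' * (qd p i x * qd p j y' + z * (1 + int j * int p * y')) * (1 + int j * int p * y''))
          + int j * int j * (1 + int i * int p * (x' + x'')) * (qd p i x * y'' * h y' + z * y' * y''))"
    unfolding u v w zc.simps star.simps qd_add unfolding E
    by (simp add: algebra_simps)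
  then have "Q dvd zc (star u v) w - zc u (star v w)"
    by (metis dvd_triv_left)
  then show ?thesis
    using nrm_shift[of "zc (star u v) w" 0 0 "zc u (star v w)" "y + y' + y''" "x + x' + x''"]
    by (simp add: u v w add.assoc del: zc.simps) 
qed

end

text \<open>Such a \<open>w\<close> is prime to p or p times a number prime to p, so inverting that
  number modulo p^K gives the multiple. It is applied to a commutator exponent and to a
  determinant.\<close>

lemma multiple_cong_prime:
  fixes p K :: nat and w :: int
  assumes p: "prime p" and w: "\<not> int p * int p dvd w"
  shows "\<exists>x. int p ^ K dvd x * w - int p"
proof -
  have cop: "coprime v (int p ^ K)" if "\<not> int p dvd v" for v
    using that p prime_imp_coprime[of "int p" v] by (simp add: coprime_commute)
  show ?thesis
  proof (cases "int p dvd w")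
    case True
    then obtain v where v: "w = int p * v" by (auto elim: dvdE)
    then have "coprime v (int p ^ K)"
      using w cop by auto
    then obtain x y where xy: "x * v + y * int p ^ K = 1"
      using bezout_int by (metis coprime_imp_gcd_eq_1)
    have "x * w - int p = int p * (x * v + y * int p ^ K) - int p - int p ^ K * (int p * y)"
      unfolding v by (simp add: algebra_simps)
    also have "\<dots> = int p ^ K * (- int p * y)"
      unfolding xy by simp
    finally show ?thesis by (metis dvd_triv_left)
  next
    case False
    then obtain x y where xy: "x * w + y * int p ^ K = 1"
      using bezout_int cop by (metis coprime_imp_gcd_eq_1)
    have "int p * x * w - int p = int p * (x * w + y * int p ^ K) - int p - int p ^ K * (int p * y)"
      by (simp add: algebra_simps)
    also have "\<dots> = int p ^ K * (- int p * y)"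
      unfolding xy by simp
    finally show ?thesis by (metis dvd_triv_left)
  qed
qed

section \<open>The group structure of the model and its coordinates\<close>

context triples
begin

lemma mult_T: "u \<otimes>\<^bsub>T\<^esub> v = nrm (star u v)" and one_T: "\<one>\<^bsub>T\<^esub> = (0, 0, 0)"
  by (simp_all add: T_def)

lemma nrm_eq_iff: "nrm (y, x, z) = nrm (y, x, z') \<longleftrightarrow> Q dvd z - z'"
  by (simp add: mod_eq_dvd_iff)

lemma group_T: "group T"
proof (rule groupI)
  fix u v w
  show "u \<otimes>\<^bsub>T\<^esub> v \<in> carrier T" by (simp add: mult_T nrm_closed)
  show "u \<otimes>\<^bsub>T\<^esub> v \<otimes>\<^bsub>T\<^esub> w = u \<otimes>\<^bsub>T\<^esub> (v \<otimes>\<^bsub>T\<^esub> w)"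
    by (simp add: mult_T nrm_star_left nrm_star_right nrm_star_assoc)
next
  show "\<one>\<^bsub>T\<^esub> \<in> carrier T" using pos p_gt_1 by (auto simp: T_def)
next
  fix u assume u: "u \<in> carrier T"
  then show "\<one>\<^bsub>T\<^esub> \<otimes>\<^bsub>T\<^esub> u = u"
    by (cases u) (simp only: mult_T one_T star.simps zc.simps, simp add: nrm_id del: nrm.simps)
  obtain y x z where yxz: "u = (y, x, z)" by (cases u) auto
  \<comment> \<open>\<open>F\<close> is the exponent of c produced when a^(-x) moves past b^y. Then
    \<open>w\<close> solves z + (1 + i p x) (F + w (1 + j p y)) = 0 modulo p^2, where 1 - i p x and
    1 - j p y invert the two factors.\<close>
  define F where "F = qd p i (- x) * qd p j y"
  define w where "w = - (1 - int j * int p * y) * (F + z * (1 - int i * int p * x))"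
  have "zc (- y, - x, w) u = Q * (int i * int i * x * x * z
      + int j * int j * y * y * (1 + int i * int p * x) * (F + z * (1 - int i * int p * x)))"
    unfolding yxz zc.simps F_def[symmetric] w_def by (simp add: algebra_simps)
  then have "Q dvd zc (- y, - x, w) u" by simp
  then have "nrm (- y, - x, w) \<otimes>\<^bsub>T\<^esub> u = \<one>\<^bsub>T\<^esub>"
    unfolding mult_T nrm_star_left by (simp add: yxz one_T del: zc.simps)
  then show "\<exists>v\<in>carrier T. v \<otimes>\<^bsub>T\<^esub> u = \<one>\<^bsub>T\<^esub>"
    using nrm_closed by blast
qed

sublocale T: group T by (rule group_T)

lemma order_T: "order T = p ^ (N + M + 2)"
  by (simp add: T_def order_def card_cartesian_product power_add nat_mult_distrib nat_power_eq
      power2_eq_square)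

lemma finite_T: "finite (carrier T)"
  by (simp add: T_def)

lemma fst_mult: "fst (u \<otimes>\<^bsub>T\<^esub> v) = (fst u + fst v) mod B"
  and snd_mult: "fst (snd (u \<otimes>\<^bsub>T\<^esub> v)) = (fst (snd u) + fst (snd v)) mod A"
  by (cases u; cases v; simp add: mult_T)+

lemma fst_inv: "fst (inv\<^bsub>T\<^esub> u) = (- fst u) mod B"
  and snd_inv: "fst (snd (inv\<^bsub>T\<^esub> u)) = (- fst (snd u)) mod A" if "u \<in> carrier T" for u
proof -
  have *: "a = (- b) mod q" if "(a + b) mod q = 0" "a \<in> {0..<q}" for a b q :: int
    using that by (metis add.inverse_inverse add_diff_cancel_right' atLeastLessThan_iff diff_0
        diff_minus_eq_add mod_diff_left_eq mod_pos_pos_trivial)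
  have "inv\<^bsub>T\<^esub> u \<in> {0..<B} \<times> {0..<A} \<times> {0..<Q}"
    using T.inv_closed[OF that] by (simp add: T_def)
  moreover have "(fst (inv\<^bsub>T\<^esub> u) + fst u) mod B = 0"
    "(fst (snd (inv\<^bsub>T\<^esub> u)) + fst (snd u)) mod A = 0"
    using T.l_inv[OF that] by (simp_all add: fst_mult[symmetric] snd_mult[symmetric] one_T)
  ultimately show "fst (inv\<^bsub>T\<^esub> u) = (- fst u) mod B"
    "fst (snd (inv\<^bsub>T\<^esub> u)) = (- fst (snd u)) mod A"
    using * by (metis mem_Times_iff)+
qed

section \<open>Powers, commutators and the central powers of c\<close>

lemma fst_pow: "u \<in> carrier T \<Longrightarrow> fst (u [^]\<^bsub>T\<^esub> (k::nat)) = (int k * fst u) mod B"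
  and snd_pow: "u \<in> carrier T \<Longrightarrow> fst (snd (u [^]\<^bsub>T\<^esub> k)) = (int k * fst (snd u)) mod A"
  by (induction k) (simp_all add: one_T fst_mult snd_mult mod_simps algebra_simps)

lemma pow_a: "(0, 1, 0) [^]\<^bsub>T\<^esub> (k::nat) = nrm (0, int k, 0)"
  and pow_b: "(1, 0, 0) [^]\<^bsub>T\<^esub> k = nrm (int k, 0, 0)"
  and pow_c: "nrm (0, 0, w) [^]\<^bsub>T\<^esub> k = nrm (0, 0, int k * w)"
proof -
  have eq: "u [^]\<^bsub>T\<^esub> Suc k = nrm (star v w)" if "u [^]\<^bsub>T\<^esub> k = nrm v" "u = w" for u v w k
    using that by (simp add: mult_T nrm_star_left)
  show "(0, 1, 0) [^]\<^bsub>T\<^esub> k = nrm (0, int k, 0)"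
    by (induction k, simp add: one_T, subst eq, assumption, rule HOL.refl) (simp add: add.commute)
  show "(1, 0, 0) [^]\<^bsub>T\<^esub> k = nrm (int k, 0, 0)"
    by (induction k, simp add: one_T, subst eq, assumption, rule HOL.refl) (simp add: add.commute)
  show "nrm (0, 0, w) [^]\<^bsub>T\<^esub> k = nrm (0, 0, int k * w)"
  proof (induction k)
    case (Suc k)
    then show ?case
      by (simp only: T.nat_pow_Suc mult_T nrm_star_left nrm_star_right) (simp add: algebra_simps)
  qed (simp add: one_T)
qed

lemma mult_c: "(y, x, z) \<otimes>\<^bsub>T\<^esub> nrm (0, 0, t) = nrm (y, x, z + t)"
  unfolding mult_T nrm_star_right by (simp add: add.commute)

text \<open>The first two coordinates of a product are symmetric in the factors.\<close>

lemma commute_iff: "u \<otimes>\<^bsub>T\<^esub> v = v \<otimes>\<^bsub>T\<^esub> u \<longleftrightarrow> Q dvd zc u v - zc v u"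
proof (cases u; cases v)
  fix y x z y' x' z'
  assume "u = (y, x, z)" "v = (y', x', z')"
  then show ?thesis
    using nrm_eq_iff[of "y + y'" "x + x'" "zc u v" "zc v u"]
    by (simp add: mult_T add.commute del: zc.simps nrm.simps)
qed

text \<open>Moving a power of c past \<open>u\<close> multiplies its exponent by factors congruent
  to 1 modulo p, which fixes multiples of p modulo p^2.\<close>

lemma central_c: "nrm (0, 0, int p * k) \<otimes>\<^bsub>T\<^esub> u = u \<otimes>\<^bsub>T\<^esub> nrm (0, 0, int p * k)"
proof -
  obtain y x z where u: "u = (y, x, z)" by (cases u) auto
  have "zc (0, 0, int p * k) u - zc u (0, 0, int p * k)
      = Q * (k * (int j * y + int i * x * (1 + int j * int p * y)))"
    unfolding u zc.simps by (simp add: algebra_simps)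
  then have "(0, 0, int p * k) \<otimes>\<^bsub>T\<^esub> u = u \<otimes>\<^bsub>T\<^esub> (0, 0, int p * k)"
    unfolding commute_iff by (metis dvd_triv_left)
  then show ?thesis
    unfolding mult_T nrm_star_left nrm_star_right .
qed

text \<open>The commutator of \<open>u\<close> and \<open>v\<close> is c^w with \<open>w\<close> not
  divisible by p^2, so c^p is among its powers.\<close>

lemma c_pow_in_subgroup:
  assumes H: "subgroup H T" and uv: "u \<in> H" "v \<in> H" "u \<otimes>\<^bsub>T\<^esub> v \<noteq> v \<otimes>\<^bsub>T\<^esub> u"
  shows "nrm (0, 0, int p * k) \<in> H"
proof -
  interpret H: subgroup H T by fact
  define w where "w = zc u v - zc v u"
  have "\<not> Q dvd w"
    using uv(3) commute_iff by (simp add: w_def)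
  then obtain x where x: "Q dvd x * w - int p"
    using multiple_cong_prime[OF p, of w 2] by (auto simp: power2_eq_square)
  have "(v \<otimes>\<^bsub>T\<^esub> u) \<otimes>\<^bsub>T\<^esub> nrm (0, 0, w) = u \<otimes>\<^bsub>T\<^esub> v"
    unfolding mult_T nrm_star_left nrm_star_right
    by (cases u; cases v) (simp add: w_def add.commute del: zc.simps(1), simp add: algebra_simps)
  then have "nrm (0, 0, w) = inv\<^bsub>T\<^esub> (v \<otimes>\<^bsub>T\<^esub> u) \<otimes>\<^bsub>T\<^esub> (u \<otimes>\<^bsub>T\<^esub> v)"
    using uv nrm_closed by (metis H.mem_carrier H.m_closed T.inv_solve_left)
  then have w: "nrm (0, 0, w) \<in> H"
    using uv by simp
  define n where "n = nat (k * x mod Q)"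
  have "nrm (0, 0, w) [^]\<^bsub>T\<^esub> n \<in> H"
    using w by (induction n) auto
  moreover have "Q dvd int n * w - int p * k"
  proof -
    have "int n = k * x mod Q" using pos by (simp add: n_def)
    then obtain m where m: "int n = k * x - Q * m"
      by (metis minus_mult_div_eq_mod)
    have "int n * w - int p * k = k * (x * w - int p) - Q * (m * w)"
      unfolding m by (simp add: algebra_simps)
    then show ?thesis
      using x by (metis dvd_diff dvd_mult dvd_triv_left)
  qed
  ultimately show ?thesis
    unfolding pow_c using nrm_eq_iff by metis
qed

section \<open>The order bound from a determinant that is nonzero modulo p^2\<close>

lemma inj_on_fibre: "inj_on (\<lambda>k. (z + int p * k) mod Q) {0..<int p}"
proof (rule inj_onI)
  fix k l assume kl: "k \<in> {0..<int p}" "l \<in> {0..<int p}"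
    "(z + int p * k) mod Q = (z + int p * l) mod Q"
  then have "int p * int p dvd int p * (k - l)"
    by (simp add: mod_eq_dvd_iff algebra_simps)
  then have "int p dvd k - l"
    using p_gt_1 by simp
  then show "k = l"
    using kl zdvd_imp_le[of "int p" "k - l"] zdvd_imp_le[of "int p" "l - k"]
    by (cases k l rule: linorder_cases) (auto simp: dvd_diff_commute)
qed

lemma card_multiples: "card {x \<in> {0..<int p ^ Suc K}. int p dvd x} = p ^ K"
proof -
  have "{x \<in> {0..<int p ^ Suc K}. int p dvd x} = (\<lambda>k. int p * k) ` {0..<int p ^ K}"
    using p_gt_1 by (auto simp: zero_le_mult_iff elim!: dvdE)
  moreover have "inj_on (\<lambda>k. int p * k) S" for S
    using p_gt_1 by (auto intro: inj_onI)
  ultimately show ?thesis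
    by (simp only: card_image) (simp add: nat_power_eq)
qed

text \<open>\<open>F\<close> has order p^(N+M), so the larger \<open>S\<close> has order at least
  p^(N+M+1). Since \<open>H\<close> already contains the powers of c^p, adjoining c enlarges it at
  most p-fold.\<close>

lemma card_ge_if_det:
  assumes H: "subgroup H T" and uv: "u \<in> H" "v \<in> H" "u \<otimes>\<^bsub>T\<^esub> v \<noteq> v \<otimes>\<^bsub>T\<^esub> u"
    and det: "\<not> Q dvd fst (snd u) * fst v - fst (snd v) * fst u"
  shows "p ^ (N + M) \<le> card H"
proof -
  interpret H: subgroup H T by fact
  \<comment> \<open>\<open>S\<close> is $H\langle c\rangle$, and \<open>F\<close> below is $\langle a^p, b^p, c\rangle$\<close>
  define S where "S = {g \<in> carrier T. \<exists>h\<in>H. fst g = fst h \<and> fst (snd g) = fst (snd h)}"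
  have S: "subgroup S T"
  proof (rule T.subgroupI)
    show "S \<subseteq> carrier T" "S \<noteq> {}"
      using H.one_closed T.one_closed unfolding S_def by blast+
    fix g assume g: "g \<in> S"
    then obtain h where h: "h \<in> H" "fst g = fst h" "fst (snd g) = fst (snd h)"
      by (auto simp: S_def)
    then show "inv\<^bsub>T\<^esub> g \<in> S"
      using g by (auto simp: S_def fst_inv snd_inv intro!: bexI[of _ "inv\<^bsub>T\<^esub> h"])
    fix g' assume "g' \<in> S"
    moreover then obtain h' where "h' \<in> H" "fst g' = fst h'" "fst (snd g') = fst (snd h')"
      by (auto simp: S_def)
    ultimately show "g \<otimes>\<^bsub>T\<^esub> g' \<in> S"
      using g h by (auto simp: S_def fst_mult snd_mult intro!: bexI[of _ "h \<otimes>\<^bsub>T\<^esub> h'"])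
  qed
  define F where "F = {g \<in> carrier T. int p dvd fst g \<and> int p dvd fst (snd g)}"
  have "F \<subseteq> S"
  proof
    fix g assume g: "g \<in> F"
    then obtain y x where yx: "fst g = int p * y" "fst (snd g) = int p * x"
      by (auto simp: F_def elim!: dvdE)
    let ?D = "fst (snd u) * fst v - fst (snd v) * fst u"
    obtain k where k: "int p ^ (N + M) dvd k * ?D - int p"
      using multiple_cong_prime[OF p det] by blast
    \<comment> \<open>A common modulus for both coordinates, which also allows natural numbers as
      exponents.\<close>
    define q where "q = int p ^ (N + M)"
    have qAB: "A dvd q" "B dvd q" "q > 0"
      using p_gt_1 by (simp_all add: q_def power_add)
    \<comment> \<open>Cramer's rule: as \<open>k * ?D\<close> is p modulo \<open>q\<close>, the pair
      (a, b) expresses the coordinates (p y, p x) of \<open>g\<close> through those of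
      \<open>u\<close> and \<open>v\<close>.\<close>
    define a where "a = k * (x * fst v - y * fst (snd v))"
    define b where "b = k * (y * fst (snd u) - x * fst u)"
    obtain m n where mn: "int m = a mod q" "int n = b mod q"
      using qAB(3) by (metis int_nat_eq pos_mod_sign)
    define h where "h = u [^]\<^bsub>T\<^esub> m \<otimes>\<^bsub>T\<^esub> v [^]\<^bsub>T\<^esub> n"
    have "w [^]\<^bsub>T\<^esub> n \<in> H" if "w \<in> H" for w and n :: nat
      using that by (induction n) auto
    then have "h \<in> H"
      unfolding h_def using uv by simp
    moreover have "q dvd fst g - (a mod q * fst u + b mod q * fst v)"
      "q dvd fst (snd g) - (a mod q * fst (snd u) + b mod q * fst (snd v))"
    proof -
      obtain a' b' where ab: "a mod q = a - q * a'" "b mod q = b - q * b'"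
        by (metis minus_mult_div_eq_mod)
      have "fst g - (a mod q * fst u + b mod q * fst v)
          = - y * (k * ?D - int p) + q * (a' * fst u + b' * fst v)"
        unfolding ab yx unfolding a_def b_def by (simp add: algebra_simps)
      then show "q dvd fst g - (a mod q * fst u + b mod q * fst v)"
        using k unfolding q_def[symmetric] by (metis dvd_add dvd_mult dvd_triv_left)
      have "fst (snd g) - (a mod q * fst (snd u) + b mod q * fst (snd v))
          = - x * (k * ?D - int p) + q * (a' * fst (snd u) + b' * fst (snd v))"
        unfolding ab yx unfolding a_def b_def by (simp add: algebra_simps)
      then show "q dvd fst (snd g) - (a mod q * fst (snd u) + b mod q * fst (snd v))"
        using k unfolding q_def[symmetric] by (metis dvd_add dvd_mult dvd_triv_left)
    qed
    then have "fst g mod B = (a mod q * fst u + b mod q * fst v) mod B"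
      "fst (snd g) mod A = (a mod q * fst (snd u) + b mod q * fst (snd v)) mod A"
      using qAB by (meson mod_eq_dvd_iff dvd_trans)+
    moreover have "fst g mod B = fst g" "fst (snd g) mod A = fst (snd g)"
      using g by (auto simp: F_def T_def)
    ultimately have "fst g = fst h" "fst (snd g) = fst (snd h)"
      using qAB uv by (simp_all add: h_def fst_mult snd_mult fst_pow snd_pow mn mod_simps)
    then show "g \<in> S"
      using g \<open>h \<in> H\<close> by (auto simp: S_def F_def)
  qed
  moreover have "S \<noteq> F"
  proof
    assume "S = F"
    then have "u \<in> F" "v \<in> F"
      using uv by (auto simp: S_def)
    then have "Q dvd fst (snd u) * fst v" "Q dvd fst (snd v) * fst u"
      by (auto simp: F_def intro: mult_dvd_mono)
    then show False
      using det dvd_diff by blast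
  qed
  moreover have fS: "finite S"
    using finite_T by (simp add: S_def)
  ultimately have less: "card F < card S"
    by (simp add: psubset_card_mono psubset_eq)
  have "card F = p ^ (N + M)"
  proof -
    have "F = {x \<in> {0..<B}. int p dvd x} \<times> {x \<in> {0..<A}. int p dvd x} \<times> {0..<Q}"
      by (auto simp: F_def T_def)
    moreover obtain N' M' where "N = Suc N'" "M = Suc M'"
      using N_ge_1 M_ge_1 by (metis Suc_le_D One_nat_def)
    ultimately show ?thesis
      using card_multiples[of N'] card_multiples[of M']
      by (simp add: card_cartesian_product power_add nat_mult_distrib del: power_Suc) (simp add: power_add)
  qed
  \<comment> \<open>Being a power of p, the order of \<open>S\<close> exceeds p^(N+M) by a whole
    factor p.\<close>
  moreover obtain k where k: "card S = p ^ k"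
    using T.card_subgroup_prime_power[OF p order_T S] by blast
  ultimately have "p ^ (N + M) < p ^ k"
    using less by simp
  then have "N + M < k"
    using p_gt_1 by simp
  then have "p ^ (N + M + 1) \<le> card S"
    unfolding k using p_gt_1 by (intro power_increasing) auto
  \<comment> \<open>\<open>R\<close> is the image of \<open>H\<close> modulo <c>. Each fibre of
    \<open>S\<close> over \<open>R\<close> has at most p^2 elements, and each fibre of
    \<open>H\<close> contains a coset of <c^p>, that is, p elements.\<close>
  define R where "R = (\<lambda>(y, x, z). (y, x)) ` H"
  have finH: "finite H" using H.subset finite_T finite_subset by blast
  then have fR: "finite R" by (simp add: R_def)
  have "S \<subseteq> (\<lambda>((y, x), z). (y, x, z)) ` (R \<times> {0..<Q})"
    by (force simp: S_def R_def T_def image_iff)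
  then have "card S \<le> card (R \<times> {0..<Q})"
    using fR by (intro surj_card_le) auto
  then have SR: "card S \<le> card R * p * p"
    by (simp add: card_cartesian_product nat_mult_distrib mult.assoc)
  define \<zeta> where "\<zeta> r = (SOME z. (fst r, snd r, z) \<in> H)" for r
  have \<zeta>: "(fst r, snd r, \<zeta> r) \<in> H" if "r \<in> R" for r
  proof -
    have "\<exists>z. (fst r, snd r, z) \<in> H" using that by (auto simp: R_def)
    then show ?thesis unfolding \<zeta>_def by (rule someI_ex)
  qed
  let ?f = "\<lambda>(r, k). nrm (fst r, snd r, \<zeta> r + int p * k)"
  have f: "nrm (fst r, snd r, \<zeta> r + int p * k) = (fst r, snd r, (\<zeta> r + int p * k) mod Q)" if "r \<in> R" for r k
    using H.mem_carrier[OF \<zeta>[OF that]] by (auto simp: T_def)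
  have "inj_on ?f (R \<times> {0..<int p})"
  proof (rule inj_onI)
    fix a b assume ab: "a \<in> R \<times> {0..<int p}" "b \<in> R \<times> {0..<int p}" "?f a = ?f b"
    obtain r k r' k' where rk: "a = (r, k)" "b = (r', k')"
      by (cases a; cases b) auto
    then have R: "r \<in> R" "r' \<in> R" and k: "k \<in> {0..<int p}" "k' \<in> {0..<int p}"
      using ab by auto
    have "r = r' \<and> (\<zeta> r + int p * k) mod Q = (\<zeta> r' + int p * k') mod Q"
      using ab(3) unfolding rk prod.case f[OF R(1)] f[OF R(2)] by (auto simp: prod_eq_iff)
    then show "a = b"
      using inj_onD[OF inj_on_fibre[of "\<zeta> r"], of k k'] k by (auto simp: rk)
  qed
  moreover have "?f ` (R \<times> {0..<int p}) \<subseteq> H"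
    using c_pow_in_subgroup[OF H uv] \<zeta> by (auto simp: mult_c[symmetric] simp del: nrm.simps)
  ultimately have "card (R \<times> {0..<int p}) \<le> card H"
    using card_inj_on_le finH by blast
  then have "card R * p \<le> card H"
    by (simp add: card_cartesian_product)
  then have "card S \<le> card H * p"
    using SR mult_le_mono1 order.trans by blast
  moreover have "p ^ (N + M) * p \<le> card S"
    using \<open>p ^ (N + M + 1) \<le> card S\<close> by (simp add: mult.commute)
  ultimately have "p ^ (N + M) * p \<le> card H * p"
    by linarith
  then show ?thesis
    using p_gt_1 by simp
qed

end

section \<open>Non-abelian subgroups of the model\<close>

context triples
begin

lemma card_c_powers: "card ((\<lambda>k. nrm (0, 0, int p * k)) ` {0..<int p}) = p"
proof -
  have "inj_on (\<lambda>k. nrm (0, 0, int p * k)) {0..<int p}"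
    using inj_on_fibre[of 0] by (auto simp: inj_on_def)
  then show ?thesis by (simp only: card_image) simp
qed

text \<open>The first coordinate is the projection onto the quotient by <a, c>, cyclic of order p^M;
  <c^p> serves as the central subgroup.\<close>

lemma card_ge_if_fst_coprime:
  assumes H: "subgroup H T" "noncommuting T H" and h: "h \<in> H" "\<not> int p dvd fst h"
  shows "p ^ (M + 2) \<le> card H"
proof (rule T.card_ge_if_cyclic_projection[OF p order_T _ _ H h(1), where \<chi> = fst])
  show "coprime (fst h) (int p)"
    using h(2) p prime_imp_coprime[of "int p"] by (simp add: coprime_commute[of _ "int p"])
  show "(\<lambda>k. nrm (0, 0, int p * k)) ` {0..<int p} \<subseteq> H"
    using H c_pow_in_subgroup unfolding noncommuting_def by blast
qed (auto simp: card_c_powers fst_mult central_c simp del: nrm.simps, auto simp: T_def)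

lemma card_ge_if_snd_coprime:
  assumes H: "subgroup H T" "noncommuting T H" and h: "h \<in> H" "\<not> int p dvd fst (snd h)"
  shows "p ^ (N + 2) \<le> card H"
proof (rule T.card_ge_if_cyclic_projection[OF p order_T _ _ H h(1), where \<chi> = "\<lambda>u. fst (snd u)"])
  show "coprime (fst (snd h)) (int p)"
    using h(2) p prime_imp_coprime[of "int p"] by (simp add: coprime_commute[of _ "int p"])
  show "(\<lambda>k. nrm (0, 0, int p * k)) ` {0..<int p} \<subseteq> H"
    using H c_pow_in_subgroup unfolding noncommuting_def by blast
qed (auto simp: card_c_powers snd_mult central_c simp del: nrm.simps, auto simp: T_def)

text \<open>On multiples of p, \<open>qd\<close> is linear modulo p^2: p divides the binomial
  coefficient if p is odd, and for p = 2 the coefficient y (2 y - 1) contributes the linear part -k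
  p y. Commutator exponents then become multiples of the determinant.\<close>

lemma qd_mult_p: "\<exists>\<kappa>. \<forall>y. Q dvd qd p k (int p * y) - \<kappa> * int p * y"
proof (cases "p = 2")
  case True
  have "qd p k (int p * y) - (1 - int k) * int p * y = Q * (int k * y * y)" for y
  proof -
    have "(2 * y) * (2 * y - 1) div 2 = y * (2 * y - 1)" by simp
    then show ?thesis
      unfolding qd_def True by (simp add: algebra_simps)
  qed
  then have "Q dvd qd p k (int p * y) - (1 - int k) * int p * y" for y
    by simp
  then show ?thesis by blast
next
  case False
  have "Q dvd qd p k (int p * y) - 1 * int p * y" for y
  proof -
    have "int p dvd (int p * y) * (int p * y - 1) div 2"
      using odd_prime_dvd_half_prod[OF p False] by simp
    then show ?thesis
      by (simp add: qd_def mult_dvd_mono mult.assoc)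
  qed
  then show ?thesis by blast
qed

text \<open>With \<open>i = 0\<close> the exponent of a enters linearly, and by
  \<open>qd_mult_p\<close> so does that of b; the commutator exponent is \<open>\<kappa>\<close>
  times the determinant modulo p^2.\<close>

lemma commute_if_fst_dvd:
  assumes "i = 0" "int p dvd fst u" "int p dvd fst v"
    and det: "Q dvd fst (snd u) * fst v - fst (snd v) * fst u"
  shows "u \<otimes>\<^bsub>T\<^esub> v = v \<otimes>\<^bsub>T\<^esub> u"
proof -
  obtain y x z y' x' z' where u: "u = (int p * y, x, z)" and v: "v = (int p * y', x', z')"
    using assms(2,3) by (metis dvdE prod.collapse)
  obtain \<kappa> where \<kappa>: "\<And>y. Q dvd qd p j (int p * y) - \<kappa> * int p * y"
    using qd_mult_p by blast
  have "zc u v - zc v u = x * (qd p j (int p * y') - \<kappa> * int p * y')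
      - x' * (qd p j (int p * y) - \<kappa> * int p * y) + \<kappa> * (x * (int p * y') - x' * (int p * y))
      + Q * (int j * (z * y' - z' * y))"
    unfolding u v zc.simps unfolding assms(1) by (simp add: qd_def[of _ 0] algebra_simps)
  also have "Q dvd \<dots>"
    by (rule dvd_add[OF dvd_add[OF dvd_diff[OF dvd_mult[OF \<kappa>] dvd_mult[OF \<kappa>]]
          dvd_mult[OF det[unfolded u v fst_conv snd_conv]]] dvd_triv_left])
  finally show ?thesis by (simp add: commute_iff)
qed

text \<open>The mirror image, with extra factors 1 + i p x' that are 1 modulo p^2 because p divides
  the exponents of a.\<close>

lemma commute_if_snd_dvd:
  assumes "j = 0" "int p dvd fst (snd u)" "int p dvd fst (snd v)"
    and det: "Q dvd fst (snd u) * fst v - fst (snd v) * fst u"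
  shows "u \<otimes>\<^bsub>T\<^esub> v = v \<otimes>\<^bsub>T\<^esub> u"
proof -
  obtain y x z y' x' z' where u: "u = (y, int p * x, z)" and v: "v = (y', int p * x', z')"
    using assms(2,3) by (metis dvdE prod.collapse)
  obtain \<kappa> where \<kappa>: "\<And>x. Q dvd qd p i (int p * x) - \<kappa> * int p * x"
    using qd_mult_p by blast
  have "zc u v - zc v u
      = (1 + int i * int p * (int p * x')) * y' * (qd p i (int p * x) - \<kappa> * int p * x)
      - (1 + int i * int p * (int p * x)) * y * (qd p i (int p * x') - \<kappa> * int p * x')
      + \<kappa> * (int p * x * y' - int p * x' * y)
      + Q * (int i * (x' * z - x * z' + \<kappa> * int p * x * x' * (y' - y)))"
    unfolding u v zc.simps unfolding assms(1) by (simp add: qd_def[of _ 0] algebra_simps)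
  also have "Q dvd \<dots>"
    by (rule dvd_add[OF dvd_add[OF dvd_diff[OF dvd_mult[OF \<kappa>] dvd_mult[OF \<kappa>]]
          dvd_mult[OF det[unfolded u v fst_conv snd_conv]]] dvd_triv_left])
  finally show ?thesis by (simp add: commute_iff)
qed

text \<open>This is <a, c>, and the analogue for the second coordinate is <b, c>. They attain the
  minimum when only a, respectively only b, acts nontrivially on c.\<close>

lemma subgroup_fst_0: "subgroup {u \<in> carrier T. fst u = 0} T"
  by (rule T.subgroupI) (use T.one_closed in \<open>auto simp: fst_mult fst_inv one_T\<close>)

lemma subgroup_snd_0: "subgroup {u \<in> carrier T. fst (snd u) = 0} T"
  by (rule T.subgroupI) (use T.one_closed in \<open>auto simp: snd_mult snd_inv one_T\<close>)

lemma card_fst_0: "card {u \<in> carrier T. fst u = 0} = p ^ (N + 2)"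
proof -
  have "{u \<in> carrier T. fst u = 0} = {0} \<times> {0..<A} \<times> {0..<Q}"
    using pos by (auto simp: T_def)
  then show ?thesis
    by (simp add: card_cartesian_product nat_mult_distrib nat_power_eq power_add power2_eq_square)
qed

lemma card_snd_0: "card {u \<in> carrier T. fst (snd u) = 0} = p ^ (M + 2)"
proof -
  have "{u \<in> carrier T. fst (snd u) = 0} = {0..<B} \<times> {0} \<times> {0..<Q}"
    using pos by (auto simp: T_def)
  then show ?thesis
    by (simp add: card_cartesian_product nat_mult_distrib nat_power_eq power_add power2_eq_square)
qed

lemma AB_gt_1: "A > 1" "B > 1" "Q > 1"
  using p_gt_1 N_ge_1 M_ge_1 by (simp_all add: less_1_mult one_less_power)

lemma Q_dvd_p_mult: "Q dvd int p * k \<longleftrightarrow> int p dvd k"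
  using p_gt_1 by simp

lemma noncommuting_fst_0:
  assumes "\<not> p dvd i"
  shows "noncommuting T {u \<in> carrier T. fst u = 0}"
proof -
  have "\<not> Q dvd int p * int i"
    unfolding Q_dvd_p_mult using assms by simp
  then have "(0, 0, 1) \<otimes>\<^bsub>T\<^esub> (0, 1, 0) \<noteq> (0, 1, 0) \<otimes>\<^bsub>T\<^esub> (0, 0, 1)"
    unfolding commute_iff by (simp add: algebra_simps)
  moreover have "(0, 0, 1) \<in> carrier T" "(0, 1, 0) \<in> carrier T"
    using AB_gt_1 p_gt_1 by (auto simp: T_def)
  ultimately show ?thesis
    unfolding noncommuting_def by (metis (mono_tags, lifting) fst_conv mem_Collect_eq)
qed

lemma noncommuting_snd_0:
  assumes "\<not> p dvd j"
  shows "noncommuting T {u \<in> carrier T. fst (snd u) = 0}"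
proof -
  have "\<not> Q dvd int p * int j"
    unfolding Q_dvd_p_mult using assms by simp
  then have "(0, 0, 1) \<otimes>\<^bsub>T\<^esub> (1, 0, 0) \<noteq> (1, 0, 0) \<otimes>\<^bsub>T\<^esub> (0, 0, 1)"
    unfolding commute_iff by (simp add: algebra_simps)
  moreover have "(0, 0, 1) \<in> carrier T" "(1, 0, 0) \<in> carrier T"
    using AB_gt_1 p_gt_1 by (auto simp: T_def)
  ultimately show ?thesis
    unfolding noncommuting_def by (metis (mono_tags, lifting) fst_conv snd_conv mem_Collect_eq)
qed

section \<open>The value of \<open>I_max\<close> in the model, by the action of a and b on c\<close>

lemma zc_class2: "i = 0 \<Longrightarrow> j = 0 \<Longrightarrow> zc (y, x, z) (y', x', z') = z' + z + x * y'"
  unfolding zc.simps by (simp add: qd_def)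

lemma has_I_max_class2:
  assumes P: "group P" "h \<in> iso P T" and ij: "i = 0" "j = 0"
  shows "has_I_max p P 2"
proof -
  have NM: "N \<ge> 2" "M \<ge> 2"
    using N M ij by auto
  \<comment> \<open>This is <a, b^p, c^p>.\<close>
  define H where "H = {u \<in> carrier T. int p dvd fst u \<and> int p dvd snd (snd u)}"
  have pQ: "int p dvd (m mod Q) \<longleftrightarrow> int p dvd m" "int p dvd (m mod B) \<longleftrightarrow> int p dvd m" for m
    by (simp_all add: dvd_mod_iff p_dvd_B)
  \<comment> \<open>Modulo p the last coordinate is additive here, because a^x and b^(p m) have
    commutator c^(p x m).\<close>
  have mult: "int p dvd snd (snd (u \<otimes>\<^bsub>T\<^esub> v)) \<longleftrightarrow> int p dvd snd (snd v) + snd (snd u)"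
    if "int p dvd fst v" for u v
  proof -
    obtain y x z y' x' z' where uv: "u = (y, x, z)" "v = (y', x', z')"
      by (cases u; cases v) auto
    have "int p dvd y'"
      using that uv by simp
    then obtain m where "y' = int p * m" by (elim dvdE)
    then have "snd (snd (u \<otimes>\<^bsub>T\<^esub> v))
      = (z' + z + int p * (x * m + int s * ((y + y') div B) + int r * ((x + x') div A))) mod Q"
      by (simp add: uv mult_T zc_class2[OF ij] algebra_simps del: zc.simps)
    then show ?thesis
      by (simp add: pQ uv dvd_add_left_iff)
  qed
  have sub: "subgroup H T"
  proof (rule T.subgroupI)
    show "H \<subseteq> carrier T" "H \<noteq> {}"
      using T.one_closed by (auto simp: H_def one_T intro!: exI[of _ 0])
    fix u assume u: "u \<in> H"
    then have d: "int p dvd fst (inv\<^bsub>T\<^esub> u)"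
      by (auto simp: H_def fst_inv pQ)
    moreover have "int p dvd snd (snd (u \<otimes>\<^bsub>T\<^esub> inv\<^bsub>T\<^esub> u))"
      using u by (simp add: H_def one_T)
    ultimately show "inv\<^bsub>T\<^esub> u \<in> H"
      using u unfolding mult[OF d] by (auto simp: H_def dvd_add_left_iff)
    fix v assume "v \<in> H"
    then show "u \<otimes>\<^bsub>T\<^esub> v \<in> H"
      using u mult[of v u] by (auto simp: H_def fst_mult pQ)
  qed
  have cardH: "card H = p ^ (N + M)"
  proof -
    have "H = {x \<in> {0..<B}. int p dvd x} \<times> {0..<A} \<times> {x \<in> {0..<int p ^ Suc 1}. int p dvd x}"
      by (auto simp: H_def T_def)
    moreover obtain M' where "M = Suc M'"
      using M_ge_1 by (metis Suc_le_D One_nat_def)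
    ultimately show ?thesis
      using card_multiples[of M'] card_multiples[of 1]
      by (simp add: card_cartesian_product nat_power_eq del: power_Suc) (simp add: power_add)
  qed
  \<comment> \<open>Ensures that (p, 0, 0), which stands for b^p, is a reduced triple.\<close>
  have "int p ^ 1 < int p ^ M"
    using p_gt_1 NM by (intro power_strict_increasing) auto
  then have in_H: "(int p, 0, 0) \<in> H" "(0, 1, 0) \<in> H"
    using AB_gt_1 p_gt_1 by (auto simp: H_def T_def)
  have "\<not> Q dvd int p * 1"
    unfolding Q_dvd_p_mult using p_gt_1 by simp
  then have "(0, 1, 0) \<otimes>\<^bsub>T\<^esub> (int p, 0, 0) \<noteq> (int p, 0, 0) \<otimes>\<^bsub>T\<^esub> (0, 1, 0)"
    unfolding commute_iff zc_class2[OF ij] by simp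
  then have nc: "noncommuting T H"
    unfolding noncommuting_def using in_H by blast
  show ?thesis
  proof (rule has_I_max_isoI[OF P(1) group_T P(2) p _ sub cardH nc])
    show "order T = p ^ (2 + (N + M))"
      by (simp add: order_T add.commute)
    fix K assume K: "subgroup K T" "noncommuting T K"
    then obtain u v where uv: "u \<in> K" "v \<in> K" "u \<otimes>\<^bsub>T\<^esub> v \<noteq> v \<otimes>\<^bsub>T\<^esub> u"
      by (auto simp: noncommuting_def)
    \<comment> \<open>In class two the commutator exponent is the determinant itself.\<close>
    have "zc u v - zc v u = fst (snd u) * fst v - fst (snd v) * fst u"
      by (cases u; cases v) (simp add: zc_class2[OF ij] del: zc.simps)
    then show "p ^ (N + M) \<le> card K"
      using card_ge_if_det[OF K(1) uv] uv(3) commute_iff by auto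
  qed
qed

lemma has_I_max_b_acts:
  assumes P: "group P" "h \<in> iso P T" and ij: "i = 0" "\<not> p dvd j"
  shows "has_I_max p P N"
proof (rule has_I_max_isoI[OF P(1) group_T P(2) p _ subgroup_snd_0 card_snd_0 noncommuting_snd_0[OF ij(2)]])
  show "order T = p ^ (N + (M + 2))"
    by (simp add: order_T)
  fix K assume K: "subgroup K T" "noncommuting T K"
  then obtain u v where uv: "u \<in> K" "v \<in> K" "u \<otimes>\<^bsub>T\<^esub> v \<noteq> v \<otimes>\<^bsub>T\<^esub> u"
    by (auto simp: noncommuting_def)
  show "p ^ (M + 2) \<le> card K"
  proof (cases "int p dvd fst u \<and> int p dvd fst v")
    case True
    then have "p ^ (N + M) \<le> card K"
      using card_ge_if_det[OF K(1) uv] uv(3) commute_if_fst_dvd[OF ij(1)] by blast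
    \<comment> \<open>As \<open>i = 0\<close> is even, N >= 2, so the determinant bound
      suffices.\<close>
    moreover have "p ^ (M + 2) \<le> p ^ (N + M)"
      using N ij(1) p_gt_1 by (intro power_increasing) auto
    ultimately show ?thesis by linarith
  next
    case False
    then show ?thesis
      using card_ge_if_fst_coprime[OF K] uv by blast
  qed
qed

lemma has_I_max_a_acts:
  assumes P: "group P" "h \<in> iso P T" and ij: "\<not> p dvd i" "j = 0"
  shows "has_I_max p P M"
proof (rule has_I_max_isoI[OF P(1) group_T P(2) p _ subgroup_fst_0 card_fst_0 noncommuting_fst_0[OF ij(1)]])
  show "order T = p ^ (M + (N + 2))"
    by (simp add: order_T add.commute add.left_commute)
  fix K assume K: "subgroup K T" "noncommuting T K"
  then obtain u v where uv: "u \<in> K" "v \<in> K" "u \<otimes>\<^bsub>T\<^esub> v \<noteq> v \<otimes>\<^bsub>T\<^esub> u"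
    by (auto simp: noncommuting_def)
  show "p ^ (N + 2) \<le> card K"
  proof (cases "int p dvd fst (snd u) \<and> int p dvd fst (snd v)")
    case True
    then have "p ^ (N + M) \<le> card K"
      using card_ge_if_det[OF K(1) uv] uv(3) commute_if_snd_dvd[OF ij(2)] by blast
    moreover have "p ^ (N + 2) \<le> p ^ (N + M)"
      using M ij(2) p_gt_1 by (intro power_increasing) auto
    ultimately show ?thesis by linarith
  next
    case False
    then show ?thesis
      using card_ge_if_snd_coprime[OF K] uv by blast
  qed
qed

text \<open>For non-commuting u and v the elements 1, u, v, uv, vu are distinct, and a power of 2
  that is at least 5 is at least 8.\<close>

lemma eight_le_card:
  assumes "p = 2" and K: "subgroup K T" "noncommuting T K"
  shows "2 ^ 3 \<le> card K"
proof -
  interpret K: subgroup K T by fact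
  obtain u v where uv: "u \<in> K" "v \<in> K" "u \<otimes>\<^bsub>T\<^esub> v \<noteq> v \<otimes>\<^bsub>T\<^esub> u"
    using K(2) by (auto simp: noncommuting_def)
  have c: "u \<in> carrier T" "v \<in> carrier T" using uv by auto
  have "distinct [\<one>\<^bsub>T\<^esub>, u, v, u \<otimes>\<^bsub>T\<^esub> v, v \<otimes>\<^bsub>T\<^esub> u]"
  proof -
    have "u \<noteq> \<one>\<^bsub>T\<^esub>" "v \<noteq> \<one>\<^bsub>T\<^esub>" "u \<noteq> v"
      using uv(3) c by auto
    moreover have "u \<otimes>\<^bsub>T\<^esub> v \<noteq> \<one>\<^bsub>T\<^esub>" "v \<otimes>\<^bsub>T\<^esub> u \<noteq> \<one>\<^bsub>T\<^esub>"
      using uv(3) c T.inv_comm by metis+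
    moreover have "u \<otimes>\<^bsub>T\<^esub> v \<noteq> u" "v \<otimes>\<^bsub>T\<^esub> u \<noteq> u" "u \<otimes>\<^bsub>T\<^esub> v \<noteq> v" "v \<otimes>\<^bsub>T\<^esub> u \<noteq> v"
      using calculation(1,2) c by simp_all
    ultimately show ?thesis
      using uv(3) by (metis distinct.simps(2) distinct_singleton set_ConsD)
  qed
  then have "card (set [\<one>\<^bsub>T\<^esub>, u, v, u \<otimes>\<^bsub>T\<^esub> v, v \<otimes>\<^bsub>T\<^esub> u]) = 5"
    by (simp only: distinct_card) simp
  moreover have "set [\<one>\<^bsub>T\<^esub>, u, v, u \<otimes>\<^bsub>T\<^esub> v, v \<otimes>\<^bsub>T\<^esub> u] \<subseteq> K"
    using uv by auto
  ultimately have "5 \<le> card K"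
    using finite_T K.subset by (metis card_mono finite_subset)
  moreover obtain k where k: "card K = 2 ^ k"
    using T.card_subgroup_prime_power[OF p order_T K(1)] assms(1) by blast
  ultimately have "(2::nat) ^ 2 < 2 ^ k" by simp
  then have "2 < k" by (rule power_less_imp_less_exp[rotated]) simp
  then show ?thesis
    unfolding k by (intro power_increasing) auto
qed

text \<open>The order is 2^5, and <b, c> or <a, c> has order 8 according as \<open>M\<close> or
  \<open>N\<close> is 1.\<close>

lemma has_I_max_both_act:
  assumes P: "group P" "h \<in> iso P T" and "p = 2" "odd i" "odd j" "N = 2 \<and> M = 1 \<or> N = 1 \<and> M = 2"
  shows "has_I_max 2 P 2"
proof -
  have ij: "\<not> p dvd i" "\<not> p dvd j" using assms by auto
  have ord: "order T = 2 ^ (2 + 3)"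
    using order_T assms(3,6) by auto
  have sub: "\<exists>H. subgroup H T \<and> card H = 2 ^ 3 \<and> noncommuting T H"
    using assms(6)
  proof
    assume "N = 2 \<and> M = 1"
    then have "card {u \<in> carrier T. fst (snd u) = 0} = 2 ^ 3"
      using card_snd_0 assms(3) by simp
    then show ?thesis
      using subgroup_snd_0 noncommuting_snd_0[OF ij(2)] by blast
  next
    assume "N = 1 \<and> M = 2"
    then have "card {u \<in> carrier T. fst u = 0} = 2 ^ 3"
      using card_fst_0 assms(3) by simp
    then show ?thesis
      using subgroup_fst_0 noncommuting_fst_0[OF ij(1)] by blast
  qed
  then obtain H where H: "subgroup H T" "card H = 2 ^ 3" "noncommuting T H"
    by blast
  show ?thesis
    by (rule has_I_max_isoI[OF P(1) group_T P(2) two_is_prime_nat ord H eight_le_card[OF assms(3)]])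
qed

end

section \<open>Presentations\<close>

context group
begin

context
  fixes f :: "'g \<Rightarrow> 'a"
  assumes f: "\<And>x. f x \<in> carrier G"
begin

lemma gw_eval_closed: "gw_eval G f w \<in> carrier G"
  by (induction w) (auto simp: f)

lemma gw_eval_append: "gw_eval G f (u @ v) = gw_eval G f u \<otimes> gw_eval G f v"
  by (induction u) (auto simp: f gw_eval_closed m_assoc)

lemma gw_eval_inv: "gw_eval G f (gw_inv w) = inv (gw_eval G f w)"
proof (induction w)
  case (Cons l w)
  have "gw_inv (l # w) = gw_inv w @ [(fst l, \<not> snd l)]"
    by (simp add: gw_inv_def case_prod_beta)
  then show ?case
    by (simp add: gw_eval_append Cons f gw_eval_closed inv_mult_group)
qed (simp add: gw_inv_def)

lemma gw_eval_pow: "gw_eval G f (w \<up> k) = gw_eval G f w [^] k"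
proof (induction k)
  case (Suc k)
  then show ?case
    using nat_pow_Suc2[OF gw_eval_closed] by (simp add: gw_pow_def gw_eval_append)
qed (simp add: gw_pow_def)

text \<open>An inverse-free form of commutator relations, which can be checked directly by
  multiplying triples.\<close>

lemma gw_eval_comm_eq_iff:
  assumes "z \<in> carrier G"
  shows "gw_eval G f (gw_comm u v) = z
    \<longleftrightarrow> gw_eval G f u \<otimes> gw_eval G f v = gw_eval G f v \<otimes> gw_eval G f u \<otimes> z"
proof -
  have "inv x \<otimes> (inv y \<otimes> (x \<otimes> y)) = z \<longleftrightarrow> x \<otimes> y = y \<otimes> x \<otimes> z"
    if "x \<in> carrier G" "y \<in> carrier G" for x y
  proof -
    have "inv x \<otimes> (inv y \<otimes> (x \<otimes> y)) = inv (y \<otimes> x) \<otimes> (x \<otimes> y)"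
      using that by (simp add: inv_mult_group m_assoc)
    then show ?thesis
      using that assms inv_solve_left[of z "y \<otimes> x" "x \<otimes> y"] by auto
  qed
  then show ?thesis
    by (simp add: gw_comm_def gw_eval_append gw_eval_inv gw_eval_closed)
qed

end

lemma pow_shift:
  assumes "x \<in> carrier G" "y \<in> carrier G" "g \<in> carrier G" "x \<otimes> g = g \<otimes> y"
  shows "x [^] (n::nat) \<otimes> g = g \<otimes> y [^] n"
proof (induction n)
  case (Suc n)
  have "x [^] Suc n \<otimes> g = x [^] n \<otimes> g \<otimes> y"
    using assms by (simp add: m_assoc)
  then show ?case
    using assms by (simp add: Suc m_assoc)
qed (use assms in simp)

end

definition satisfies :: "('h, 'm) monoid_scheme \<Rightarrow> ('g \<Rightarrow> 'h) \<Rightarrow> ('g gword \<times> 'g gword) set \<Rightarrow> bool" where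
  "satisfies H f R \<longleftrightarrow> (\<forall>(u, v)\<in>R. gw_eval H f u = gw_eval H f v)"

lemma gw_eval_presented_group:
  "gw_eval (presented_group R) (\<lambda>x. pres_class R [(x, True)]) w = pres_class R w"
proof (induction w)
  case (Cons l w)
  interpret group "presented_group R" by (rule group_presented_group)
  have "inv\<^bsub>presented_group R\<^esub> pres_class R [(x, True)] = pres_class R [(x, False)]" for x
  proof (rule inv_equality)
    show "pres_class R [(x, False)] \<otimes>\<^bsub>presented_group R\<^esub> pres_class R [(x, True)] = \<one>\<^bsub>presented_group R\<^esub>"
      using pres_cong.cancel[of R x False]
      by (simp add: mult_presented_group one_presented_group pres_class_eq_iff)
  qed (auto simp: carrier_presented_group)
  then show ?case
    by (cases l) (simp add: Cons mult_presented_group)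
qed (simp add: one_presented_group)

lemma satisfies_presented_group:
  "satisfies (presented_group R) (\<lambda>x. pres_class R [(x, True)]) R"
  by (auto simp: satisfies_def gw_eval_presented_group presented_group_relation)

section \<open>Normal forms and the isomorphism with the model\<close>

definition std_rels ::
    "nat \<Rightarrow> nat \<Rightarrow> nat \<Rightarrow> nat \<Rightarrow> nat \<Rightarrow> nat \<Rightarrow> nat \<Rightarrow> ('a, 'm) monoid_scheme \<Rightarrow> 'a \<Rightarrow> 'a \<Rightarrow> 'a \<Rightarrow> bool" where
  "std_rels p N M r s i j G a b c \<longleftrightarrow>
    c [^]\<^bsub>G\<^esub> (p ^ 2) = \<one>\<^bsub>G\<^esub> \<and> a [^]\<^bsub>G\<^esub> (p ^ N) = c [^]\<^bsub>G\<^esub> (r * p) \<and> b [^]\<^bsub>G\<^esub> (p ^ M) = c [^]\<^bsub>G\<^esub> (s * p) \<and>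
    a \<otimes>\<^bsub>G\<^esub> b = b \<otimes>\<^bsub>G\<^esub> a \<otimes>\<^bsub>G\<^esub> c \<and> c \<otimes>\<^bsub>G\<^esub> a = a \<otimes>\<^bsub>G\<^esub> c \<otimes>\<^bsub>G\<^esub> c [^]\<^bsub>G\<^esub> (i * p) \<and>
    c \<otimes>\<^bsub>G\<^esub> b = b \<otimes>\<^bsub>G\<^esub> c \<otimes>\<^bsub>G\<^esub> c [^]\<^bsub>G\<^esub> (j * p)"

text \<open>Collection: the products b^y a^x c^z are closed under right multiplication by the
  generators and their inverses, and the power relations then bound the exponents.\<close>

lemma (in group) std_rels_normal_form:
  assumes rels: "std_rels p N M r s i j G (f Gen_a) (f Gen_b) (f Gen_c)"
    and f: "\<And>x. f x \<in> carrier G" and p: "p > 0"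
  shows "\<exists>y<p ^ M. \<exists>x<p ^ N. \<exists>z<p ^ 2.
    gw_eval G f w = f Gen_b [^] y \<otimes> f Gen_a [^] x \<otimes> f Gen_c [^] z"
proof -
  define a where "a = f Gen_a"
  define b where "b = f Gen_b"
  define c where "c = f Gen_c"
  have [simp]: "a \<in> carrier G" "b \<in> carrier G" "c \<in> carrier G"
    by (simp_all add: a_def b_def c_def f)
  note rels = rels[unfolded std_rels_def, folded a_def b_def c_def]
  have ca: "\<exists>t'. c [^] (t::nat) \<otimes> a = a \<otimes> c [^] (t'::nat)" for t
  proof -
    have "c \<otimes> a = a \<otimes> c [^] Suc (i * p)"
      using rels by (subst nat_pow_Suc2) (simp_all add: m_assoc)
    then have "c [^] t \<otimes> a = a \<otimes> (c [^] Suc (i * p)) [^] t"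
      by (intro pow_shift) simp_all
    then show ?thesis by (auto simp only: nat_pow_pow \<open>c \<in> carrier G\<close>)
  qed
  have cb: "\<exists>t'. c [^] (t::nat) \<otimes> b = b \<otimes> c [^] (t'::nat)" for t
  proof -
    have "c \<otimes> b = b \<otimes> c [^] Suc (j * p)"
      using rels by (subst nat_pow_Suc2) (simp_all add: m_assoc)
    then have "c [^] t \<otimes> b = b \<otimes> (c [^] Suc (j * p)) [^] t"
      by (intro pow_shift) simp_all
    then show ?thesis by (auto simp only: nat_pow_pow \<open>c \<in> carrier G\<close>)
  qed
  have cax: "\<exists>t'. c [^] (t::nat) \<otimes> a [^] (x::nat) = a [^] x \<otimes> c [^] (t'::nat)" for t x
  proof (induction x)
    case (Suc x)
    then obtain t' :: nat where t': "c [^] t \<otimes> a [^] x = a [^] x \<otimes> c [^] t'" by blast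
    obtain t'' :: nat where "c [^] t' \<otimes> a = a \<otimes> c [^] t''" using ca by blast
    then have "c [^] t \<otimes> a [^] Suc x = a [^] Suc x \<otimes> c [^] t''"
      using t' by (simp add: m_assoc[symmetric]) (simp add: m_assoc)
    then show ?case by blast
  qed auto
  \<comment> \<open>Needed because a^x b = b (a c)^x. The exponent of c is irrelevant, as only an
    upper bound on the set of normal forms is sought.\<close>
  have acx: "\<exists>t. (a \<otimes> c) [^] (x::nat) = a [^] x \<otimes> c [^] (t::nat)" for x
  proof (induction x)
    case (Suc x)
    then obtain t :: nat where t: "(a \<otimes> c) [^] x = a [^] x \<otimes> c [^] t" by blast
    obtain t' :: nat where "c [^] t \<otimes> a = a \<otimes> c [^] t'" using ca by blast
    then have "a [^] x \<otimes> c [^] t \<otimes> (a \<otimes> c) = a [^] x \<otimes> a \<otimes> (c [^] t' \<otimes> c)"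
      by (simp add: m_assoc[symmetric]) (simp add: m_assoc)
    then have "(a \<otimes> c) [^] Suc x = a [^] Suc x \<otimes> c [^] Suc t'"
      using t by simp
    then show ?case by blast
  qed (auto intro!: exI[of _ 0])
  define S where "S = {b [^] y \<otimes> a [^] x \<otimes> c [^] z | (x::nat) (y::nat) (z::nat). True}"
  have S: "b [^] y \<otimes> a [^] x \<otimes> c [^] z \<in> S" for x y z :: nat
    unfolding S_def by blast
  have Sc: "u \<otimes> c \<in> S" if u: "u \<in> S" for u
  proof -
    obtain x y z :: nat where "u = b [^] y \<otimes> a [^] x \<otimes> c [^] z"
      using u unfolding S_def by blast
    then have "u \<otimes> c = b [^] y \<otimes> a [^] x \<otimes> c [^] Suc z"
      by (simp add: m_assoc)
    then show ?thesis by (metis S)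
  qed
  have Sa: "u \<otimes> a \<in> S" if u: "u \<in> S" for u
  proof -
    obtain x y z :: nat where u: "u = b [^] y \<otimes> a [^] x \<otimes> c [^] z"
      using u unfolding S_def by blast
    obtain t :: nat where "c [^] z \<otimes> a = a \<otimes> c [^] t" using ca by blast
    then have "u \<otimes> a = b [^] y \<otimes> a [^] Suc x \<otimes> c [^] t"
      by (simp add: u m_assoc)
    then show ?thesis by (metis S)
  qed
  have Sb: "u \<otimes> b \<in> S" if u: "u \<in> S" for u
  proof -
    obtain x y z :: nat where u: "u = b [^] y \<otimes> a [^] x \<otimes> c [^] z"
      using u unfolding S_def by blast
    obtain t :: nat where t: "c [^] z \<otimes> b = b \<otimes> c [^] t" using cb by blast
    obtain q :: nat where q: "(a \<otimes> c) [^] x = a [^] x \<otimes> c [^] q" using acx by blast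
    have ab: "a [^] x \<otimes> b = b \<otimes> (a \<otimes> c) [^] x"
      by (rule pow_shift) (use rels in \<open>simp_all add: m_assoc\<close>)
    have "u \<otimes> b = b [^] y \<otimes> (a [^] x \<otimes> b) \<otimes> c [^] t"
      by (simp add: u m_assoc t)
    also have "\<dots> = b [^] Suc y \<otimes> a [^] x \<otimes> (c [^] q \<otimes> c [^] t)"
      unfolding ab q by (simp add: m_assoc)
    also have "\<dots> = b [^] Suc y \<otimes> a [^] x \<otimes> c [^] (q + t)"
      by (simp add: nat_pow_mult)
    finally show ?thesis by (metis S)
  qed
  have S_carrier: "u \<in> carrier G" if "u \<in> S" for u
    using that by (auto simp: S_def)
  have c_ord: "c [^] (k * (p ^ 2)) = \<one>" for k :: nat
  proof -
    have "(c [^] (p ^ 2)) [^] k = \<one>" using rels by simp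
    then show ?thesis by (simp add: nat_pow_pow mult.commute)
  qed
  \<comment> \<open>An element of finite order has a positive power as inverse, so closure under the
    generators is enough.\<close>
  have invS: "u \<otimes> inv g \<in> S"
    if closed: "\<And>u. u \<in> S \<Longrightarrow> u \<otimes> g \<in> S" and u: "u \<in> S"
      and g: "g \<in> carrier G" "g [^] Suc n = \<one>" for u g and n :: nat
  proof -
    have uc: "u \<in> carrier G" using u by (rule S_carrier)
    have "u \<otimes> g [^] k \<in> S" for k :: nat
    proof (induction k)
      case (Suc k)
      then show ?case using closed[OF Suc] uc g by (simp add: m_assoc)
    qed (use u uc in simp)
    moreover have "inv g = g [^] n"
      using g by (intro inv_equality) simp_all
    ultimately show ?thesis by simp
  qed
  have order: "\<exists>n. g [^] Suc n = \<one>" if "g [^] m = c [^] (k * p)" "m > 0" "g \<in> carrier G" for g and m k :: nat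
  proof -
    have "(g [^] m) [^] p = c [^] (k * p ^ 2)"
      unfolding that(1) by (simp add: nat_pow_pow power2_eq_square mult.assoc)
    then have "g [^] (m * p) = \<one>"
      using c_ord that(3) by (simp add: nat_pow_pow)
    moreover have "m * p > 0" using that(2) p by simp
    then obtain n where "m * p = Suc n"
      using gr0_implies_Suc by blast
    ultimately show ?thesis by metis
  qed
  have inv_closed: "u \<otimes> inv f x \<in> S" if "u \<in> S" for u x
  proof (cases x)
    case Gen_a
    then show ?thesis
      using invS[OF Sa that] order[of a "p ^ N" r] rels p by (auto simp: a_def[symmetric])
  next
    case Gen_b
    then show ?thesis
      using invS[OF Sb that] order[of b "p ^ M" s] rels p by (auto simp: b_def[symmetric])
  next
    case Gen_c
    then show ?thesis
      using invS[OF Sc that] order[of c "p ^ 2" 0] rels p by (auto simp: c_def[symmetric])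
  qed
  have closed: "u \<otimes> f x \<in> S" if "u \<in> S" for u x
    using that Sa Sb Sc by (cases x) (auto simp: a_def b_def c_def)
  have "u \<otimes> gw_eval G f w \<in> S" if "u \<in> S" for u
    using that
  proof (induction w arbitrary: u)
    case Nil
    then show ?case by (simp add: S_carrier)
  next
    case (Cons l w)
    let ?g = "if snd l then f (fst l) else inv f (fst l)"
    have "u \<otimes> ?g \<otimes> gw_eval G f w \<in> S"
      using Cons closed inv_closed by simp
    moreover have "u \<in> carrier G" using Cons.prems by (rule S_carrier)
    ultimately show ?case
      using f gw_eval_closed[of f] by (simp add: m_assoc split: if_splits)
  qed
  from this[of \<one>] have "gw_eval G f w \<in> S"
    using S[of 0 0 0] gw_eval_closed[of f] f by simp
  then obtain x y z :: nat where w: "gw_eval G f w = b [^] y \<otimes> a [^] x \<otimes> c [^] z"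
    unfolding S_def by blast
  have red: "g [^] n = g [^] (n mod m) \<otimes> c [^] (k * p * (n div m))"
    if "g [^] m = c [^] (k * p)" "g \<in> carrier G" for g and n m k :: nat
  proof -
    have "g [^] n = g [^] (n mod m + m * (n div m))" by simp
    also have "\<dots> = g [^] (n mod m) \<otimes> (g [^] m) [^] (n div m)"
      using that(2) by (simp only: nat_pow_mult[symmetric] nat_pow_pow)
    also have "(g [^] m) [^] (n div m) = c [^] (k * p * (n div m))"
      unfolding that(1) by (simp add: nat_pow_pow)
    finally show ?thesis .
  qed
  \<comment> \<open>Reducing the exponent of b leaves a power of c to the left of a^x, which has to
    be moved across.\<close>
  obtain t :: nat where t: "c [^] (s * p * (y div p ^ M)) \<otimes> a [^] x = a [^] x \<otimes> c [^] t"
    using cax by blast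
  define q where "q = r * p * (x div p ^ N) + (t + z)"
  have "gw_eval G f w = b [^] (y mod p ^ M) \<otimes> (a [^] x \<otimes> c [^] t) \<otimes> c [^] z"
    unfolding w t[symmetric] using red[of b "p ^ M" s y] rels by (simp add: m_assoc)
  also have "a [^] x = a [^] (x mod p ^ N) \<otimes> c [^] (r * p * (x div p ^ N))"
    using red[of a "p ^ N" r x] rels by simp
  also have "b [^] (y mod p ^ M) \<otimes> (a [^] (x mod p ^ N) \<otimes> c [^] (r * p * (x div p ^ N)) \<otimes> c [^] t) \<otimes> c [^] z
      = b [^] (y mod p ^ M) \<otimes> a [^] (x mod p ^ N) \<otimes> c [^] q"
    by (simp add: q_def m_assoc nat_pow_mult add.assoc)
  also have "c [^] q = c [^] (q mod p ^ 2)"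
    using red[of c "p ^ 2" 0 q] rels by simp
  finally show ?thesis
    using p by (intro exI[of _ "y mod p ^ M"] exI[of _ "x mod p ^ N"] exI[of _ "q mod p ^ 2"] conjI)
      (simp_all add: a_def b_def c_def)
qed

context triples
begin

primrec gens :: "gen3 \<Rightarrow> int \<times> int \<times> int" where
  "gens Gen_a = (0, 1, 0)"
| "gens Gen_b = (1, 0, 0)"
| "gens Gen_c = (0, 0, 1)"

lemma gens_closed: "gens x \<in> carrier T"
  using AB_gt_1 p_gt_1 by (cases x) (auto simp: T_def)

lemma pow_gen_c: "(0, 0, 1) [^]\<^bsub>T\<^esub> (k::nat) = nrm (0, 0, int k)"
  using pow_c[of 1 k] AB_gt_1 by simp

lemma std_rels_gens: "std_rels p N M r s i j T (gens Gen_a) (gens Gen_b) (gens Gen_c)"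
  unfolding std_rels_def gens.simps pow_a pow_b pow_gen_c mult_T nrm_star_left nrm_star_right one_T
  using pos by (simp add: power2_eq_square algebra_simps)

lemma normal_form_gens:
  assumes "y < p ^ M" "x < p ^ N" "z < p ^ 2"
  shows "gens Gen_b [^]\<^bsub>T\<^esub> y \<otimes>\<^bsub>T\<^esub> gens Gen_a [^]\<^bsub>T\<^esub> x \<otimes>\<^bsub>T\<^esub> gens Gen_c [^]\<^bsub>T\<^esub> z = (int y, int x, int z)"
proof -
  have "int y < B" "int x < A" "int z < Q"
    using assms by (simp_all add: power2_eq_square flip: of_nat_power of_nat_mult)
  then show ?thesis
    unfolding gens.simps pow_a pow_b pow_gen_c mult_T nrm_star_left nrm_star_right by simp
qed

text \<open>The homomorphism of von Dyck sends a normal form to the triple of its exponents. Every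
  element has a normal form, so the map is injective, and every triple is reached.\<close>

lemma presented_group_iso:
  assumes T: "satisfies T gens R"
    and P: "std_rels p N M r s i j (presented_group R)
      (pres_class R [(Gen_a, True)]) (pres_class R [(Gen_b, True)]) (pres_class R [(Gen_c, True)])"
  shows "\<exists>h. h \<in> iso (presented_group R) T"
proof -
  let ?P = "presented_group R"
  let ?f = "\<lambda>x. pres_class R [(x, True)]"
  interpret P: group ?P by (rule group_presented_group)
  obtain h where h: "h \<in> hom ?P T" "\<And>w. h (pres_class R w) = gw_eval T gens w"
  proof (rule presented_group_universal[OF group_T, of gens R])
    show "gw_eval T gens u = gw_eval T gens v" if "(u, v) \<in> R" for u v
      using T that by (auto simp: satisfies_def)
  qed (use gens_closed in blast)+
  interpret group_hom ?P T h
    by unfold_locales (rule h)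
  have f: "?f x \<in> carrier ?P" for x
    by (auto simp: carrier_presented_group)
  have hf: "h (?f x) = gens x" for x
    using gens_closed[of x] by (simp add: h(2))
  define F where "F y x z = ?f Gen_b [^]\<^bsub>?P\<^esub> y \<otimes>\<^bsub>?P\<^esub> ?f Gen_a [^]\<^bsub>?P\<^esub> x \<otimes>\<^bsub>?P\<^esub> ?f Gen_c [^]\<^bsub>?P\<^esub> z"
    for x y z :: nat
  have hF: "h (F y x z) = (int y, int x, int z)" if "y < p ^ M" "x < p ^ N" "z < p ^ 2" for x y z
    using normal_form_gens[OF that] f by (simp add: F_def hom_nat_pow hf del: gens.simps)
  have F: "\<exists>y<p ^ M. \<exists>x<p ^ N. \<exists>z<p ^ 2. u = F y x z" if u: "u \<in> carrier ?P" for u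
  proof -
    obtain w where "u = pres_class R w"
      using u by (auto simp: carrier_presented_group)
    then show ?thesis
      using P.std_rels_normal_form[OF P f, of w] p_gt_1
      by (simp add: gw_eval_presented_group F_def)
  qed
  have "inj_on h (carrier ?P)"
  proof (rule inj_onI)
    fix u v assume "u \<in> carrier ?P" "v \<in> carrier ?P" and eq: "h u = h v"
    then obtain y x z y' x' z' where
      u: "u = F y x z" "y < p ^ M" "x < p ^ N" "z < p ^ 2" and
      v: "v = F y' x' z'" "y' < p ^ M" "x' < p ^ N" "z' < p ^ 2"
      using F by meson
    then show "u = v"
      using eq hF[OF u(2-4)] hF[OF v(2-4)] by simp
  qed
  moreover have "carrier T \<subseteq> h ` carrier ?P"
  proof
    fix t assume t: "t \<in> carrier T"
    then obtain y x z where yxz: "t = (y, x, z)" "0 \<le> y" "y < B" "0 \<le> x" "x < A" "0 \<le> z" "z < Q"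
      by (auto simp: T_def)
    then have "h (F (nat y) (nat x) (nat z)) = t"
      by (subst hF) (simp_all add: nat_less_iff power2_eq_square)
    moreover have "F (nat y) (nat x) (nat z) \<in> carrier ?P"
      using f by (simp add: F_def)
    ultimately show "t \<in> h ` carrier ?P" by blast
  qed
  ultimately have "bij_betw h (carrier ?P) (carrier T)"
    by (auto simp: bij_betw_def)
  then show ?thesis
    using h(1) unfolding iso_def by blast
qed

end

text \<open>Each set of relations is tested in the group presented by the other, where it must hold;
  hence the two word congruences coincide. Only groups over this one carrier type are needed for
  that.\<close>

lemma presented_group_cong:
  fixes R R' :: "('g gword \<times> 'g gword) set"
  assumes "\<And>(G :: 'g gword set monoid) f. group G \<Longrightarrow> (\<And>x. f x \<in> carrier G) \<Longrightarrow>
    satisfies G f R \<longleftrightarrow> satisfies G f R'"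
  shows "presented_group R = presented_group R'"
proof -
  have le: "pres_cong S u v"
    if "pres_cong S' u v" and S': "satisfies (presented_group S) (\<lambda>x. pres_class S [(x, True)]) S'"
    for S S' :: "('g gword \<times> 'g gword) set" and u v
    using that(1)
  proof (induction rule: pres_cong.induct)
    case (relation u v)
    then show ?case
      using S' by (auto simp: satisfies_def gw_eval_presented_group pres_class_eq_iff)
  qed (blast intro: pres_cong.intros)+
  have sat: "satisfies (presented_group S) (\<lambda>x. pres_class S [(x, True)]) R
    \<longleftrightarrow> satisfies (presented_group S) (\<lambda>x. pres_class S [(x, True)]) R'" for S
    by (rule assms) (auto simp: group_presented_group carrier_presented_group)
  have "pres_cong R = pres_cong R'"
    using le[of R' _ _ R] le[of R _ _ R'] sat satisfies_presented_group by blast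
  then have "pres_rel R = pres_rel R'"
    by (simp add: pres_rel_def)
  then show ?thesis
    by (simp add: presented_group_def pres_class_def[abs_def])
qed

section \<open>The listed presentations as members of one family\<close>

abbreviation (input) wa :: "gen3 gword" where "wa \<equiv> [(Gen_a, True)]"
abbreviation (input) wb :: "gen3 gword" where "wb \<equiv> [(Gen_b, True)]"
abbreviation (input) wc :: "gen3 gword" where "wc \<equiv> [(Gen_c, True)]"

text \<open>Kept apart from the power relations, since only the latter need rewriting to bring a
  listed presentation into the common form.\<close>

definition comm_rels :: "nat \<Rightarrow> nat \<Rightarrow> nat \<Rightarrow> (gen3 gword \<times> gen3 gword) set" where
  "comm_rels p i j = {gw_comm wa wb \<doteq> wc, gw_comm wc wa \<doteq> wc \<up> (i * p), gw_comm wc wb \<doteq> wc \<up> (j * p)}"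

definition power_rels :: "nat \<Rightarrow> nat \<Rightarrow> nat \<Rightarrow> nat \<Rightarrow> nat \<Rightarrow> (gen3 gword \<times> gen3 gword) set" where
  "power_rels p N M r s =
    {wc \<up> (p ^ 2) \<doteq> [], wa \<up> (p ^ N) \<doteq> wc \<up> (r * p), wb \<up> (p ^ M) \<doteq> wc \<up> (s * p)}"

definition std_group :: "nat \<Rightarrow> nat \<Rightarrow> nat \<Rightarrow> nat \<Rightarrow> nat \<Rightarrow> nat \<Rightarrow> nat \<Rightarrow> gen3 gword set monoid" where
  "std_group p N M r s i j = presented_group (power_rels p N M r s \<union> comm_rels p i j)"

lemma (in group) satisfies_std_rels_iff:
  assumes f: "\<And>x. f x \<in> carrier G"
  shows "satisfies G f (power_rels p N M r s \<union> comm_rels p i j)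
    \<longleftrightarrow> std_rels p N M r s i j G (f Gen_a) (f Gen_b) (f Gen_c)"
proof -
  have 1: "gw_eval G f [(x, True)] = f x" for x
    using f by simp
  show ?thesis
    unfolding satisfies_def comm_rels_def power_rels_def std_rels_def
    by (simp add: gw_eval_pow gw_eval_comm_eq_iff f 1 conj_ac del: gw_eval.simps(2))
qed

lemma (in triples) std_group_iso: "\<exists>h. h \<in> iso (std_group p N M r s i j) T"
  unfolding std_group_def
proof (rule presented_group_iso)
  let ?R = "power_rels p N M r s \<union> comm_rels p i j"
  show "satisfies T gens ?R"
    using T.satisfies_std_rels_iff[of gens, OF gens_closed] std_rels_gens by blast
  show "std_rels p N M r s i j (presented_group ?R)
      (pres_class ?R wa) (pres_class ?R wb) (pres_class ?R wc)"
    by (rule iffD1[OF group.satisfies_std_rels_iff[OF group_presented_group,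
            where f = "\<lambda>x. pres_class ?R [(x, True)]"]])
      (auto simp: carrier_presented_group satisfies_presented_group)
qed

lemma (in triples) group_std_group: "group (std_group p N M r s i j)"
  by (simp add: std_group_def group_presented_group)

section \<open>Values for the family and identification of the listed groups\<close>

lemma std_group_I_max_class2:
  assumes "prime p" "N \<ge> 2" "M \<ge> 2"
  shows "has_I_max p (std_group p N M r s 0 0) 2"
proof -
  interpret triples p N M r s 0 0 using assms by unfold_locales auto
  show ?thesis using has_I_max_class2[OF group_std_group] std_group_iso by blast
qed

text \<open>The alternative \<open>M = 1\<close> serves the groups (B); there \<open>t\<close> is
  prime to 2, hence odd, as \<open>triples\<close> demands.\<close>

lemma std_group_I_max_b_acts:
  assumes "prime p" "N \<ge> 2" "M \<ge> 2 \<or> M = 1 \<and> p = 2" "0 < t" "t < p"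
  shows "has_I_max p (std_group p N M r s 0 t) N"
proof -
  have t: "\<not> p dvd t" using assms by (simp add: nat_dvd_not_less)
  interpret triples p N M r s 0 t using assms t by unfold_locales auto
  show ?thesis using has_I_max_b_acts[OF group_std_group _ HOL.refl t] std_group_iso by blast
qed

lemma std_group_I_max_a_acts:
  assumes "prime p" "N \<ge> 2" "M \<ge> 2" "0 < t" "t < p"
  shows "has_I_max p (std_group p N M r s t 0) M"
proof -
  have t: "\<not> p dvd t" using assms by (simp add: nat_dvd_not_less)
  interpret triples p N M r s t 0 using assms t by unfold_locales auto
  show ?thesis using has_I_max_a_acts[OF group_std_group _ t HOL.refl] std_group_iso by blast
qed

lemma std_group_I_max_both_act:
  assumes "N = 2 \<and> M = 1 \<or> N = 1 \<and> M = 2"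
  shows "has_I_max 2 (std_group 2 N M r s 1 1) 2"
proof -
  interpret triples 2 N M r s 1 1 using assms by unfold_locales auto
  show ?thesis using has_I_max_both_act[OF group_std_group] std_group_iso assms by auto
qed

text \<open>Taking p-th powers of the hypothesis; this makes the order relation on a or b equivalent
  to c^(p^2) = 1.\<close>

lemma (in group) sq_exponent_of_pow_eq:
  assumes "u \<in> carrier G" "v \<in> carrier G" "v [^] (p::nat) = u [^] (p ^ n)"
  shows "u [^] (p ^ (n + 1)) = v [^] (p ^ 2)"
proof -
  have "v [^] (p ^ 2) = (u [^] (p ^ n)) [^] p"
    unfolding assms(3)[symmetric] using assms(2) by (simp add: nat_pow_pow power2_eq_square)
  then show ?thesis
    using assms(1) by (simp add: nat_pow_pow mult.commute)
qed

text \<open>The four shapes of power relations that occur: \<open>r\<close> and \<open>s\<close>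
  record whether a^(p^N), respectively b^(p^M), is c^p or trivial.\<close>

lemma (in group) satisfies_power_rels:
  assumes f: "\<And>x. f x \<in> carrier G"
  shows "satisfies G f {wa \<up> (p ^ (N + 1)) \<doteq> [], wb \<up> (p ^ M) \<doteq> [], wc \<up> p \<doteq> wa \<up> (p ^ N)}
      \<longleftrightarrow> satisfies G f (power_rels p N M 1 0)" (is ?A)
    and "satisfies G f {wa \<up> (p ^ N) \<doteq> [], wb \<up> (p ^ M) \<doteq> [], wc \<up> (p ^ 2) \<doteq> []}
      \<longleftrightarrow> satisfies G f (power_rels p N M 0 0)" (is ?B)
    and "satisfies G f {wa \<up> (p ^ N) \<doteq> [], wb \<up> (p ^ (M + 1)) \<doteq> [], wc \<up> p \<doteq> wb \<up> (p ^ M)}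
      \<longleftrightarrow> satisfies G f (power_rels p N M 0 1)" (is ?C)
    and "satisfies G f {wa \<up> (p ^ (N + 1)) \<doteq> [], wc \<up> p \<doteq> wa \<up> (p ^ N), wa \<up> (p ^ N) \<doteq> wb \<up> (p ^ M)}
      \<longleftrightarrow> satisfies G f (power_rels p N M 1 1)" (is ?D)
proof -
  have 1: "gw_eval G f [(x, True)] = f x" for x
    using f by simp
  note [simp] = satisfies_def power_rels_def gw_eval_pow[OF f] 1
  note [simp del] = gw_eval.simps(2) power_Suc
  have a: "f Gen_a [^] (p ^ (N + 1)) = f Gen_c [^] (p ^ 2)" if "f Gen_c [^] p = f Gen_a [^] (p ^ N)"
    using sq_exponent_of_pow_eq f that by blast
  have b: "f Gen_b [^] (p ^ (M + 1)) = f Gen_c [^] (p ^ 2)" if "f Gen_c [^] p = f Gen_b [^] (p ^ M)"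
    using sq_exponent_of_pow_eq f that by blast
  show ?A using a by auto
  show ?B by auto
  show ?C using b by auto
  show ?D using a by auto
qed

lemma presented_group_eq_std_groupI:
  assumes "\<And>(G :: gen3 gword set monoid) f. group G \<Longrightarrow> (\<And>x. f x \<in> carrier G) \<Longrightarrow>
    satisfies G f S \<longleftrightarrow> satisfies G f (power_rels p N M r s)"
  shows "presented_group (S \<union> comm_rels p i j) = std_group p N M r s i j"
  unfolding std_group_def
proof (rule presented_group_cong)
  fix G :: "gen3 gword set monoid" and f :: "gen3 \<Rightarrow> gen3 gword set"
  assume "group G" "\<And>x. f x \<in> carrier G"
  then have "satisfies G f S \<longleftrightarrow> satisfies G f (power_rels p N M r s)"
    by (rule assms)
  then show "satisfies G f (S \<union> comm_rels p i j)
      \<longleftrightarrow> satisfies G f (power_rels p N M r s \<union> comm_rels p i j)"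
    unfolding satisfies_def by blast
qed

lemmas presented_group_eq_std_group =
  presented_group_eq_std_groupI[OF group.satisfies_power_rels(1)]
  presented_group_eq_std_groupI[OF group.satisfies_power_rels(2)]
  presented_group_eq_std_groupI[OF group.satisfies_power_rels(3)]
  presented_group_eq_std_groupI[OF group.satisfies_power_rels(4)]

lemma gw_pow_0: "w \<up> 0 = []"
  by (simp add: gw_pow_def)

lemmas grp_defs =
  grp_A1_def grp_A2_def grp_A3_def grp_B1_def grp_B2_def grp_B3_def
  grp_C1_def grp_C2_def grp_C3_def grp_C4_def grp_C5_def
  grp_D1_def grp_D2_def grp_D3_def grp_D4_def grp_D5_def
  grp_E1_def grp_E2_def grp_E3_def grp_E4_def grp_E5_def grp_E6_def grp_E7_def grp_E8_def grp_E9_def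

text \<open>The parameters are read off each presentation. In (A2) the relation c^2 = a^2 gives N =
  1, whereas (A1), (A3) and the groups (B) have M = 1.\<close>

lemma groups_eq_std_group:
  "grp_A1 = std_group 2 2 1 0 0 1 1"
  "grp_A2 = std_group 2 1 2 1 0 1 1"
  "grp_A3 = std_group 2 2 1 1 0 1 1"
  "grp_B1 n = std_group 2 n 1 1 0 0 1"
  "grp_B2 n = std_group 2 n 1 0 0 0 1"
  "grp_B3 n = std_group 2 n 1 0 1 0 1"
  "grp_C1 = std_group 2 2 2 1 1 0 0"
  "grp_C2 = std_group 2 2 2 1 0 0 0"
  "grp_C3 = std_group 2 2 2 1 1 0 1"
  "grp_C4 = std_group 2 2 2 1 0 0 1"
  "grp_C5 = std_group 2 2 2 1 0 1 0"
  "grp_D1 p n t = std_group p n n 1 0 0 t"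
  "grp_D2 p n = std_group p n n 1 0 1 0"
  "grp_D3 p n = std_group p n n 1 0 0 0"
  "grp_D4 p n = std_group p n n 0 0 1 0"
  "grp_D5 p n = std_group p n n 0 0 0 0"
  "grp_E1 p n m t = std_group p n m 1 0 0 t"
  "grp_E2 p n m = std_group p n m 1 0 1 0"
  "grp_E3 p n m = std_group p n m 1 0 0 0"
  "grp_E4 p n m = std_group p n m 0 1 0 1"
  "grp_E5 p n m t = std_group p n m 0 1 t 0"
  "grp_E6 p n m = std_group p n m 0 1 0 0"
  "grp_E7 p n m = std_group p n m 0 0 0 1"
  "grp_E8 p n m = std_group p n m 0 0 1 0"
  "grp_E9 p n m = std_group p n m 0 0 0 0"
proof -
  note grp_simps = grp_defs pres3_def comm_rels_def gw_pow_0
  show "grp_A1 = std_group 2 2 1 0 0 1 1"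
    using presented_group_eq_std_group(2)[of 2 2 1 1 1] by (simp add: grp_simps del: Un_insert_right)
  show "grp_A2 = std_group 2 1 2 1 0 1 1"
    using presented_group_eq_std_group(1)[of 2 1 2 1 1] by (simp add: grp_simps del: Un_insert_right)
  show "grp_A3 = std_group 2 2 1 1 0 1 1"
    using presented_group_eq_std_group(1)[of 2 2 1 1 1] by (simp add: grp_simps del: Un_insert_right)
  show "grp_B1 n = std_group 2 n 1 1 0 0 1"
    using presented_group_eq_std_group(1)[of 2 n 1 0 1] by (simp add: grp_simps del: Un_insert_right)
  show "grp_B2 n = std_group 2 n 1 0 0 0 1"
    using presented_group_eq_std_group(2)[of 2 n 1 0 1] by (simp add: grp_simps del: Un_insert_right)
  show "grp_B3 n = std_group 2 n 1 0 1 0 1"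
    using presented_group_eq_std_group(3)[of 2 n 1 0 1] by (simp add: grp_simps del: Un_insert_right)
  show "grp_C1 = std_group 2 2 2 1 1 0 0"
    using presented_group_eq_std_group(4)[of 2 2 2 0 0] by (simp add: grp_simps del: Un_insert_right)
  show "grp_C2 = std_group 2 2 2 1 0 0 0"
    using presented_group_eq_std_group(1)[of 2 2 2 0 0] by (simp add: grp_simps del: Un_insert_right)
  show "grp_C3 = std_group 2 2 2 1 1 0 1"
    using presented_group_eq_std_group(4)[of 2 2 2 0 1] by (simp add: grp_simps del: Un_insert_right)
  show "grp_C4 = std_group 2 2 2 1 0 0 1"
    using presented_group_eq_std_group(1)[of 2 2 2 0 1] by (simp add: grp_simps del: Un_insert_right)
  show "grp_C5 = std_group 2 2 2 1 0 1 0"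
    using presented_group_eq_std_group(1)[of 2 2 2 1 0] by (simp add: grp_simps del: Un_insert_right)
  show "grp_D1 p n t = std_group p n n 1 0 0 t"
    using presented_group_eq_std_group(1)[of p n n 0 t] by (simp add: grp_simps del: Un_insert_right)
  show "grp_D2 p n = std_group p n n 1 0 1 0"
    using presented_group_eq_std_group(1)[of p n n 1 0] by (simp add: grp_simps del: Un_insert_right)
  show "grp_D3 p n = std_group p n n 1 0 0 0"
    using presented_group_eq_std_group(1)[of p n n 0 0] by (simp add: grp_simps del: Un_insert_right)
  show "grp_D4 p n = std_group p n n 0 0 1 0"
    using presented_group_eq_std_group(2)[of p n n 1 0] by (simp add: grp_simps del: Un_insert_right)
  show "grp_D5 p n = std_group p n n 0 0 0 0"
    using presented_group_eq_std_group(2)[of p n n 0 0] by (simp add: grp_simps del: Un_insert_right)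
  show "grp_E1 p n m t = std_group p n m 1 0 0 t"
    using presented_group_eq_std_group(1)[of p n m 0 t] by (simp add: grp_simps del: Un_insert_right)
  show "grp_E2 p n m = std_group p n m 1 0 1 0"
    using presented_group_eq_std_group(1)[of p n m 1 0] by (simp add: grp_simps del: Un_insert_right)
  show "grp_E3 p n m = std_group p n m 1 0 0 0"
    using presented_group_eq_std_group(1)[of p n m 0 0] by (simp add: grp_simps del: Un_insert_right)
  show "grp_E4 p n m = std_group p n m 0 1 0 1"
    using presented_group_eq_std_group(3)[of p n m 0 1] by (simp add: grp_simps del: Un_insert_right)
  show "grp_E5 p n m t = std_group p n m 0 1 t 0"
    using presented_group_eq_std_group(3)[of p n m t 0] by (simp add: grp_simps del: Un_insert_right)
  show "grp_E6 p n m = std_group p n m 0 1 0 0"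
    using presented_group_eq_std_group(3)[of p n m 0 0] by (simp add: grp_simps del: Un_insert_right)
  show "grp_E7 p n m = std_group p n m 0 0 0 1"
    using presented_group_eq_std_group(2)[of p n m 0 1] by (simp add: grp_simps del: Un_insert_right)
  show "grp_E8 p n m = std_group p n m 0 0 1 0"
    using presented_group_eq_std_group(2)[of p n m 1 0] by (simp add: grp_simps del: Un_insert_right)
  show "grp_E9 p n m = std_group p n m 0 0 0 0"
    using presented_group_eq_std_group(2)[of p n m 0 0] by (simp add: grp_simps del: Un_insert_right)
qed

theorem theorem3p6:
  fixes p :: nat
  assumes "prime p"
  shows
    "(has_I_max 2 grp_A1 2 \<and>
      has_I_max 2 grp_A2 2 \<and>
      has_I_max 2 grp_A3 2 \<and>
      has_I_max 2 grp_C1 2 \<and>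
      has_I_max 2 grp_C2 2 \<and>
      has_I_max 2 grp_C3 2 \<and>
      has_I_max 2 grp_C4 2 \<and>
      has_I_max 2 grp_C5 2 \<and>
      (\<forall>n. n \<ge> 2 \<and> (p = 2 \<longrightarrow> n \<ge> 3) \<longrightarrow> has_I_max p (grp_D3 p n) 2) \<and>
      (\<forall>n. n \<ge> 2 \<and> (p = 2 \<longrightarrow> n \<ge> 3) \<longrightarrow> has_I_max p (grp_D5 p n) 2) \<and>
      (\<forall>n m. n > m \<and> m \<ge> 2 \<longrightarrow> has_I_max p (grp_E3 p n m) 2) \<and>
      (\<forall>n m. n > m \<and> m \<ge> 2 \<longrightarrow> has_I_max p (grp_E6 p n m) 2) \<and>
      (\<forall>n m. n > m \<and> m \<ge> 2 \<longrightarrow> has_I_max p (grp_E9 p n m) 2)) \<and>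
     ((\<forall>n. n \<ge> 3 \<longrightarrow> has_I_max 2 (grp_B1 n) n) \<and>
      (\<forall>n. n \<ge> 3 \<longrightarrow> has_I_max 2 (grp_B2 n) n) \<and>
      (\<forall>n. n \<ge> 3 \<longrightarrow> has_I_max 2 (grp_B3 n) n) \<and>
      (\<forall>n. \<forall>t\<in>{1..<p}. n \<ge> 2 \<and> (p = 2 \<longrightarrow> n \<ge> 3) \<longrightarrow> has_I_max p (grp_D1 p n t) n) \<and>
      (\<forall>n. n \<ge> 2 \<and> (p = 2 \<longrightarrow> n \<ge> 3) \<longrightarrow> has_I_max p (grp_D2 p n) n) \<and>
      (\<forall>n. n \<ge> 2 \<and> (p = 2 \<longrightarrow> n \<ge> 3) \<longrightarrow> has_I_max p (grp_D4 p n) n) \<and>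
      (\<forall>n m. \<forall>t\<in>{1..<p}. n > m \<and> m \<ge> 2 \<longrightarrow> has_I_max p (grp_E1 p n m t) n) \<and>
      (\<forall>n m. n > m \<and> m \<ge> 2 \<longrightarrow> has_I_max p (grp_E4 p n m) n) \<and>
      (\<forall>n m. n > m \<and> m \<ge> 2 \<longrightarrow> has_I_max p (grp_E7 p n m) n)) \<and>
     ((\<forall>n m. n > m \<and> m \<ge> 2 \<longrightarrow> has_I_max p (grp_E2 p n m) m) \<and>
      (\<forall>n m. \<forall>t\<in>{1..<p}. n > m \<and> m \<ge> 2 \<longrightarrow> has_I_max p (grp_E5 p n m t) m) \<and>
      (\<forall>n m. n > m \<and> m \<ge> 2 \<longrightarrow> has_I_max p (grp_E8 p n m) m))"
  \<comment> \<open>Each claim is now an instance of one of four cases. For (C3) and (C4) the value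
    2 arises as \<open>N\<close>, for (C5) as \<open>M\<close>.\<close>
  unfolding groups_eq_std_group
  using prime_gt_1_nat[OF assms] assms
  by (auto intro!: std_group_I_max_class2 std_group_I_max_b_acts std_group_I_max_a_acts std_group_I_max_both_act
      simp del: One_nat_def)

end
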